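(* Let $(M,\Phi^t,\mu,X,\Delta t)$ satisfy the dynamical assumptions and $k:M\times M\to\mathbb{R}$ the kernel assumptions listed in the context. Then for $\mu$-a.e. $x_0\in M$ the following holds. For every $\omega\in\mathbb{R}$, let $f_\omega:\mathcal{O}\to\mathbb{C}$, $f_\omega(x_n)=e^{in\omega\,\Delta t}$, be the Fourier function on the orbit $\mathcal{O}$ of $x_0$, with restrictions $f_\omega|X_N$ to the finite trajectories. Then: (i) $\lim_{N\to\infty} w_N(f_\omega)=\infty$ if and only if $f_\omega$ does not have an extension $\bar f_\omega\in\mathcal{H}$. Moreover, if $\bar f_\omega$ exists: (ii) $\lim_{N\to\infty} w_N(f_\omega)=\|\bar f_\omega\|_{\mathcal{H}}^2$. (iii) $\bar f_\omega$ is an eigenfunction of the Koopman operator $U^{\Delta t}$ and of the generator $V$, with corresponding eigenvalue $e^{i\omega\Delta t}$ (of $U^{\Delta t}$) and eigenfrequency $\omega+2\pi q/\Delta t$ (of $V$), respectively, for a unique $q\in\mathbb{Z}$.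
   Context: Dynamical assumptions: $\Phi^t:M\to M$, $t\in\mathbb{R}$, is a continuous flow on a metric space $M$ with an invariant ergodic Borel probability measure $\mu$ whose support $X=\operatorname{supp}\mu$ is compact and is not a fixed point of the dynamics. The system is sampled at a fixed interval $\Delta t>0$ such that $\mu$ is also ergodic for the discrete-time evolution map $\Phi^{n\Delta t}$, $n\in\mathbb{Z}$ (i.e. for the dynamics generated by $\Phi^{\Delta t}$). Orbit: for $x_0\in M$, $x_n=\Phi^{n\Delta t}(x_0)$, $\mathcal{O}=\{x_n:n\in\mathbb{Z}\}$, $X_N=\{x_0,\dots,x_{N-1}\}$. For $\mu$-a.e. $x_0$ the points $x_n$ are pairwise distinct; this is implicitly assumed. Koopman operators: $U^tf=f\circ\Phi^t$, acting as a strongly continuous one-parameter unitary group on $L^2(\mu)$. Its generator is $Vf=\lim_{t\to0}(U^tf-f)/t$ on its dense domain. A real number $\omega$ is an eigenfrequency if there is a nonzero $z\in L^2(\mu)$ with $U^tz=e^{i\omega t}z$ for all $t\in\mathbb{R}$, equivalently $Vz=i\omega z$. Kernel assumptions: $k:M\times M\to\mathbb{R}$ is the reproducing kernel of a reproducing kernel Hilbert space (RKHS) $\mathcal{H}$ of complex-valued functions on $M$, and the restriction $k|X\times X$ is continuous and strictly positive-definite (i.e. $\sum_{i,j}a_i^*a_jk(y_i,y_j)>0$ for distinct $y_i\in X$ and $a_i\in\mathbb{C}$ not all zero). Extension operator: let $\mu_N=\frac1N\sum_{n=0}^{N-1}\delta_{x_n}$, so that $L^2(\mu_N)$ is identified with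 the complex functions on $X_N$. $T_N:L^2(\mu_N)\to\mathcal{H}$ maps $f$ to the unique $h\in\mathcal{H}_N:=\operatorname{span}\{k(x_0,\cdot),\dots,k(x_{N-1},\cdot)\}$ with $h(x_n)=f(x_n)$ for $0\le n\le N-1$. Set $w_N(f)=\|T_Nf\|_{\mathcal{H}}^2$, and for $f:\mathcal{O}\to\mathbb{C}$ write $w_N(f)=w_N(f|X_N)$.
   Formalization: In (ii) the extension is taken to be the one of least RKHS norm, which is proved to exist uniquely; for other extensions (possible when the RKHS contains nonzero functions vanishing on X) the limit formula fails. Claims (i) and (iii) cover every extension. *)

theory Defs
  imports "HOL-Probability.Probability"
begin

definition continuous_flow :: "(real \<Rightarrow> 'a::topological_space \<Rightarrow> 'a) \<Rightarrow> bool" where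
  "continuous_flow \<Phi> \<longleftrightarrow>
     (\<forall>x. \<Phi> 0 x = x) \<and> (\<forall>s t x. \<Phi> (s + t) x = \<Phi> s (\<Phi> t x)) \<and>
     continuous_on UNIV (\<lambda>(t, x). \<Phi> t x)"

definition invariant_measure :: "'a measure \<Rightarrow> ('i \<Rightarrow> 'a \<Rightarrow> 'a) \<Rightarrow> bool" where
  "invariant_measure \<mu> T \<longleftrightarrow> (\<forall>i. T i \<in> measurable \<mu> \<mu> \<and> distr \<mu> \<mu> (T i) = \<mu>)"

definition ergodic_measure :: "'a measure \<Rightarrow> ('i \<Rightarrow> 'a \<Rightarrow> 'a) \<Rightarrow> bool" where
  "ergodic_measure \<mu> T \<longleftrightarrow>
     (\<forall>A\<in>sets \<mu>. (\<forall>i. T i -` A \<inter> space \<mu> = A) \<longrightarrow> measure \<mu> A = 0 \<or> measure \<mu> A = 1)"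

text \<open>The support is the smallest closed set of full measure. It is a predicate rather than
  a function because on a non-separable metric space such a set need not exist.\<close>

definition is_support :: "'a::topological_space measure \<Rightarrow> 'a set \<Rightarrow> bool" where
  "is_support \<mu> X \<longleftrightarrow>
     closed X \<and> emeasure \<mu> (- X) = 0 \<and> (\<forall>C. closed C \<and> emeasure \<mu> (- C) = 0 \<longrightarrow> X \<subseteq> C)"

definition sampled_orbit :: "(real \<Rightarrow> 'a \<Rightarrow> 'a) \<Rightarrow> real \<Rightarrow> 'a \<Rightarrow> int \<Rightarrow> 'a" where
  "sampled_orbit \<Phi> \<Delta>t x\<^sub>0 n = \<Phi> (of_int n * \<Delta>t) x\<^sub>0"

definition trajectory :: "(real \<Rightarrow> 'a \<Rightarrow> 'a) \<Rightarrow> real \<Rightarrow> 'a \<Rightarrow> nat \<Rightarrow> 'a set" where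
  "trajectory \<Phi> \<Delta>t x\<^sub>0 N = (\<lambda>n. sampled_orbit \<Phi> \<Delta>t x\<^sub>0 (int n)) ` {..<N}"

text \<open>The value at the orbit point with index \<open>n\<close> is \<open>cis (n * \<omega> * \<Delta>t)\<close>, provided
  that the orbit points are pairwise distinct, as they are for almost every starting point under
  the standing assumptions. Only the values on the orbit are meaningful.\<close>

definition orbit_fourier :: "(real \<Rightarrow> 'a \<Rightarrow> 'a) \<Rightarrow> real \<Rightarrow> 'a \<Rightarrow> real \<Rightarrow> 'a \<Rightarrow> complex" where
  "orbit_fourier \<Phi> \<Delta>t x\<^sub>0 \<omega> y = cis (of_int (the_inv (sampled_orbit \<Phi> \<Delta>t x\<^sub>0) y) * \<omega> * \<Delta>t)"

text \<open>Elements of the space are represented by functions, identified when they agree almost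
  everywhere. Using the completion makes membership depend only on the almost-everywhere class;
  this matters for elements of an RKHS, which are unconstrained off the support.\<close>

definition L2 :: "'a measure \<Rightarrow> ('a \<Rightarrow> complex) set" where
  "L2 \<mu> = {f \<in> borel_measurable (completion \<mu>). integrable (completion \<mu>) (\<lambda>x. (cmod (f x))\<^sup>2)}"

definition L2_norm :: "'a measure \<Rightarrow> ('a \<Rightarrow> complex) \<Rightarrow> real" where
  "L2_norm \<mu> f = sqrt (\<integral>x. (cmod (f x))\<^sup>2 \<partial>completion \<mu>)"

definition koopman :: "(real \<Rightarrow> 'a \<Rightarrow> 'a) \<Rightarrow> real \<Rightarrow> ('a \<Rightarrow> complex) \<Rightarrow> 'a \<Rightarrow> complex" where
  "koopman \<Phi> t f = f \<circ> \<Phi> t"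

definition koopman_eigenfunction ::
  "'a measure \<Rightarrow> (real \<Rightarrow> 'a \<Rightarrow> 'a) \<Rightarrow> real \<Rightarrow> complex \<Rightarrow> ('a \<Rightarrow> complex) \<Rightarrow> bool" where
  "koopman_eigenfunction \<mu> \<Phi> t c z \<longleftrightarrow>
     z \<in> L2 \<mu> \<and> \<not> (AE x in \<mu>. z x = 0) \<and> (AE x in \<mu>. koopman \<Phi> t z x = c * z x)"

text \<open>Graph of the generator: \<open>f\<close> is in its domain and is mapped to \<open>g\<close>.\<close>

definition koopman_generator ::
  "'a measure \<Rightarrow> (real \<Rightarrow> 'a \<Rightarrow> 'a) \<Rightarrow> ('a \<Rightarrow> complex) \<Rightarrow> ('a \<Rightarrow> complex) \<Rightarrow> bool" where
  "koopman_generator \<mu> \<Phi> f g \<longleftrightarrow> f \<in> L2 \<mu> \<and> g \<in> L2 \<mu> \<and>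
     ((\<lambda>t. L2_norm \<mu> (\<lambda>x. (koopman \<Phi> t f x - f x) / of_real t - g x)) \<longlongrightarrow> 0) (at 0)"

definition generator_eigenfunction ::
  "'a measure \<Rightarrow> (real \<Rightarrow> 'a \<Rightarrow> 'a) \<Rightarrow> real \<Rightarrow> ('a \<Rightarrow> complex) \<Rightarrow> bool" where
  "generator_eigenfunction \<mu> \<Phi> \<omega> z \<longleftrightarrow>
     \<not> (AE x in \<mu>. z x = 0) \<and> koopman_generator \<mu> \<Phi> z (\<lambda>x. \<i> * of_real \<omega> * z x)"

definition rk_norm :: "(('a \<Rightarrow> complex) \<Rightarrow> ('a \<Rightarrow> complex) \<Rightarrow> complex) \<Rightarrow> ('a \<Rightarrow> complex) \<Rightarrow> real" where
  "rk_norm ip f = sqrt (Re (ip f f))"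

definition kernel_section :: "('a \<Rightarrow> 'a \<Rightarrow> real) \<Rightarrow> 'a \<Rightarrow> 'a \<Rightarrow> complex" where
  "kernel_section k x = (\<lambda>y. complex_of_real (k x y))"

text \<open>A complex Hilbert space \<open>H\<close> of functions, with inner product \<open>ip\<close> conjugate-linear in the
  first argument, whose reproducing kernel is the real-valued \<open>k\<close>.\<close>

locale rkhs =
  fixes H :: "('a \<Rightarrow> complex) set"
    and ip :: "('a \<Rightarrow> complex) \<Rightarrow> ('a \<Rightarrow> complex) \<Rightarrow> complex"
    and k :: "'a \<Rightarrow> 'a \<Rightarrow> real"
  assumes zero_closed: "(\<lambda>_. 0) \<in> H"
    and add_closed: "\<lbrakk>f \<in> H; g \<in> H\<rbrakk> \<Longrightarrow> (\<lambda>x. f x + g x) \<in> H"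
    and scale_closed: "f \<in> H \<Longrightarrow> (\<lambda>x. c * f x) \<in> H"
    and ip_add: "\<lbrakk>f \<in> H; g \<in> H; h \<in> H\<rbrakk> \<Longrightarrow> ip h (\<lambda>x. f x + g x) = ip h f + ip h g"
    and ip_scale: "\<lbrakk>f \<in> H; h \<in> H\<rbrakk> \<Longrightarrow> ip h (\<lambda>x. c * f x) = c * ip h f"
    and ip_commute: "\<lbrakk>f \<in> H; g \<in> H\<rbrakk> \<Longrightarrow> ip f g = cnj (ip g f)"
    and ip_positive: "\<lbrakk>f \<in> H; f \<noteq> (\<lambda>_. 0)\<rbrakk> \<Longrightarrow> 0 < Re (ip f f)"
    and complete:
      "\<lbrakk>\<And>n. F n \<in> H;
        \<And>e. 0 < e \<Longrightarrow> \<exists>N. \<forall>m\<ge>N. \<forall>n\<ge>N. rk_norm ip (\<lambda>x. F m x - F n x) < e\<rbrakk>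
       \<Longrightarrow> \<exists>f\<in>H. (\<lambda>n. rk_norm ip (\<lambda>x. F n x - f x)) \<longlonglongrightarrow> 0"
    and kernel_section_closed: "kernel_section k x \<in> H"
    and reproducing: "f \<in> H \<Longrightarrow> f x = ip (kernel_section k x) f"

definition strictly_positive_definite_on :: "'a set \<Rightarrow> ('a \<Rightarrow> 'a \<Rightarrow> real) \<Rightarrow> bool" where
  "strictly_positive_definite_on X k \<longleftrightarrow>
     (\<forall>F a. finite F \<and> F \<subseteq> X \<and> (\<exists>y\<in>F. a y \<noteq> 0) \<longrightarrow>
        (let s = (\<Sum>x\<in>F. \<Sum>y\<in>F. cnj (a x) * a y * complex_of_real (k x y))
         in s \<in> \<real> \<and> 0 < Re s))"

definition kernel_span :: "('a \<Rightarrow> 'a \<Rightarrow> real) \<Rightarrow> 'a set \<Rightarrow> ('a \<Rightarrow> complex) set" where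
  "kernel_span k S = {h. \<exists>c. h = (\<lambda>y. \<Sum>s\<in>S. c s * kernel_section k s y)}"

text \<open>For a finite set \<open>S\<close>. The result depends on \<open>f\<close> only through its restriction to \<open>S\<close>.\<close>

definition extension_operator ::
  "('a \<Rightarrow> 'a \<Rightarrow> real) \<Rightarrow> 'a set \<Rightarrow> ('a \<Rightarrow> complex) \<Rightarrow> 'a \<Rightarrow> complex" where
  "extension_operator k S f = (THE h. h \<in> kernel_span k S \<and> (\<forall>s\<in>S. h s = f s))"

definition extension_energy ::
  "(('a \<Rightarrow> complex) \<Rightarrow> ('a \<Rightarrow> complex) \<Rightarrow> complex) \<Rightarrow> ('a \<Rightarrow> 'a \<Rightarrow> real) \<Rightarrow> 'a set \<Rightarrow>
   ('a \<Rightarrow> complex) \<Rightarrow> real" where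
  "extension_energy ip k S f = (rk_norm ip (extension_operator k S f))\<^sup>2"

definition is_extension ::
  "('a \<Rightarrow> complex) set \<Rightarrow> 'a set \<Rightarrow> ('a \<Rightarrow> complex) \<Rightarrow> ('a \<Rightarrow> complex) \<Rightarrow> bool" where
  "is_extension H S f h \<longleftrightarrow> h \<in> H \<and> (\<forall>s\<in>S. h s = f s)"

text \<open>If \<open>H\<close> contains nonzero functions vanishing on \<open>S\<close>, then an extension from \<open>S\<close> is not
  unique, and its norm is only determined for the extension of least norm.\<close>

definition is_minimal_extension ::
  "('a \<Rightarrow> complex) set \<Rightarrow> (('a \<Rightarrow> complex) \<Rightarrow> ('a \<Rightarrow> complex) \<Rightarrow> complex) \<Rightarrow> 'a set \<Rightarrow>
   ('a \<Rightarrow> complex) \<Rightarrow> ('a \<Rightarrow> complex) \<Rightarrow> bool" where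
  "is_minimal_extension H ip S f h \<longleftrightarrow>
     is_extension H S f h \<and> (\<forall>g. is_extension H S f g \<longrightarrow> rk_norm ip h \<le> rk_norm ip g)"

end

theory Submission
  imports Defs
begin

text \<open>The interpolant on \<open>X\<^sub>N\<close> is the orthogonal projection of any extension, so by Pythagoras the
  energies are monotone, they are bounded by the squared norm of every extension, and if they stay
  bounded then the interpolants form a Cauchy sequence whose limit is the extension of least norm.
  This limit only interpolates on the forward orbit. But recurrence and ergodicity make almost every
  forward orbit dense in \<open>X\<close>, and functions in the RKHS are continuous on \<open>X\<close>. Density therefore
  propagates the relation \<open>h \<circ> \<Phi> \<Delta>t = cis (\<omega> * \<Delta>t) \<cdot> h\<close> from the forward orbit to \<open>X\<close>, and hence to
  the backward orbit. It also shows that \<open>h \<circ> \<Phi> t\<close> is a multiple \<open>c t\<close> of \<open>h\<close> on \<open>X\<close>, where \<open>c\<close> is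
  a continuous character of the real line; its frequency is the eigenfrequency of the generator.\<close>

subsection \<open>Reproducing kernel Hilbert spaces\<close>

lemma (in rkhs) diff_closed:
  assumes "f \<in> H" "g \<in> H"
  shows "(\<lambda>x. f x - g x) \<in> H"
  using add_closed[OF assms(1) scale_closed[OF assms(2), of "-1"]] by simp

lemma (in rkhs) ip_diff:
  assumes "f \<in> H" "g \<in> H" "h \<in> H"
  shows "ip h (\<lambda>x. f x - g x) = ip h f - ip h g"
  using ip_add[OF assms(1) scale_closed[OF assms(2), of "-1"] assms(3)]
    ip_scale[OF assms(2,3), of "-1"] by simp

lemma (in rkhs) ip_diff_left:
  assumes "f \<in> H" "g \<in> H" "h \<in> H"
  shows "ip (\<lambda>x. f x - g x) h = ip f h - ip g h"
  using ip_commute[OF diff_closed[OF assms(1,2)] assms(3)] ip_diff[OF assms]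
    ip_commute[OF assms(1,3)] ip_commute[OF assms(2,3)] by simp

lemma (in rkhs) ip_scale_left:
  assumes "f \<in> H" "h \<in> H"
  shows "ip (\<lambda>x. c * f x) h = cnj c * ip f h"
  using ip_commute[OF scale_closed[OF assms(1)] assms(2)] ip_scale[OF assms]
    ip_commute[OF assms] by simp

lemma (in rkhs) ip_zero: "h \<in> H \<Longrightarrow> ip h (\<lambda>_. 0) = 0"
  using ip_scale[OF zero_closed, of h 0] by simp

lemma (in rkhs) ip_zero_left: "h \<in> H \<Longrightarrow> ip (\<lambda>_. 0) h = 0"
  using ip_zero[of h] ip_commute[OF zero_closed, of h] by simp

lemma (in rkhs) ip_nonneg: "f \<in> H \<Longrightarrow> 0 \<le> Re (ip f f)"
  using ip_positive[of f] ip_zero[OF zero_closed] by (cases "f = (\<lambda>_. 0)") auto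

lemma (in rkhs) ip_self: "f \<in> H \<Longrightarrow> ip f f = complex_of_real (Re (ip f f))"
  using ip_commute[of f f] by (simp add: complex_eq_iff)

lemma (in rkhs) rk_norm_power2: "f \<in> H \<Longrightarrow> (rk_norm ip f)\<^sup>2 = Re (ip f f)"
  by (simp add: rk_norm_def ip_nonneg)

lemma (in rkhs) rk_norm_nonneg: "f \<in> H \<Longrightarrow> 0 \<le> rk_norm ip f"
  by (simp add: rk_norm_def ip_nonneg)

lemma (in rkhs) rk_norm_diff_power2:
  assumes "f \<in> H" "g \<in> H"
  shows "(rk_norm ip (\<lambda>x. f x - g x))\<^sup>2 = Re (ip f f) - 2 * Re (ip f g) + Re (ip g g)"
  using assms ip_commute[OF assms(2,1)]
  by (simp add: rk_norm_power2 diff_closed ip_diff ip_diff_left)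

lemma (in rkhs) Cauchy_Schwarz:
  assumes f: "f \<in> H" and g: "g \<in> H"
  shows "cmod (ip f g) \<le> rk_norm ip f * rk_norm ip g"
proof (cases "f = (\<lambda>_. 0)")
  case True
  then show ?thesis using ip_zero_left[OF g] rk_norm_nonneg[OF f] rk_norm_nonneg[OF g] by simp
next
  case False
  define p where "p = Re (ip f f)"
  have p: "p > 0" using ip_positive[OF f False] by (simp add: p_def)
  have pf: "ip f f = of_real p" using ip_self[OF f] by (simp add: p_def)
  \<comment> \<open>With this coefficient \<open>a * f\<close> is the orthogonal projection of
    \<open>g\<close> onto the line through \<open>f\<close>; nonnegativity of the squared norm of
    the remainder is the inequality.\<close>
  define a where "a = ip f g / of_real p"
  have af: "(\<lambda>x. a * f x) \<in> H" by (rule scale_closed[OF f])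
  have gf: "ip g f = cnj (ip f g)" by (rule ip_commute[OF g f])
  have "0 \<le> (rk_norm ip (\<lambda>x. g x - a * f x))\<^sup>2" by simp
  also have "\<dots> = Re (ip g g) - 2 * Re (a * ip g f) + Re (a * (cnj a * ip f f))"
    using rk_norm_diff_power2[OF g af] by (simp add: ip_scale ip_scale_left f g af)
  also have "a * ip g f = of_real ((cmod (ip f g))\<^sup>2 / p)"
    by (simp add: a_def gf complex_norm_square[symmetric] flip: of_real_power)
  also have "a * (cnj a * ip f f) = of_real ((cmod (ip f g))\<^sup>2 / p)"
    using p by (simp add: a_def pf complex_norm_square[symmetric] flip: of_real_power)
  finally have "(cmod (ip f g))\<^sup>2 \<le> p * Re (ip g g)"
    using p by (simp add: field_simps)
  also have "\<dots> = (rk_norm ip f * rk_norm ip g)\<^sup>2"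
    by (simp add: power_mult_distrib rk_norm_power2 f g p_def)
  finally show ?thesis
    by (rule power2_le_imp_le) (simp add: rk_norm_nonneg f g)
qed

section \<open>Bounded point evaluations and continuity on \<open>X\<close>\<close>

lemma (in rkhs) norm_eval_le:
  "f \<in> H \<Longrightarrow> cmod (f x) \<le> rk_norm ip (kernel_section k x) * rk_norm ip f"
  using Cauchy_Schwarz[OF kernel_section_closed, of f x] reproducing[of f x] by simp

lemma (in rkhs) ip_kernel_section:
  "ip (kernel_section k x) (kernel_section k y) = complex_of_real (k y x)"
  using reproducing[OF kernel_section_closed, of y x] by (simp add: kernel_section_def)

lemma (in rkhs) kernel_symmetric: "k x y = k y x"
  using ip_commute[OF kernel_section_closed kernel_section_closed, of x y]
  by (simp add: ip_kernel_section)

text \<open>By the reproducing property, \<open>h y - h x\<close> is the inner product of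
  \<open>h\<close> with a difference of kernel sections. Cauchy-Schwarz reduces the claim to
  \<open>d y\<close> tending to 0, and the square of \<open>d y\<close> is a combination of kernel
  values, continuous on \<open>X\<close>.\<close>

lemma rkhs_continuous_on:
  fixes X :: "'a::metric_space set"
  assumes "rkhs H ip k" and cont: "continuous_on (X \<times> X) (\<lambda>(x, y). k x y)" and h: "h \<in> H"
  shows "continuous_on X h"
proof -
  interpret rkhs H ip k by fact
  have "(h \<longlongrightarrow> h x) (at x within X)" if x: "x \<in> X" for x
  proof -
    define d where "d y = rk_norm ip (\<lambda>z. kernel_section k y z - kernel_section k x z)" for y
    have d: "(d y)\<^sup>2 = k y y - 2 * k x y + k x x" for y
      by (simp add: d_def rk_norm_diff_power2 kernel_section_closed ip_kernel_section)
    have "continuous_on X (\<lambda>y. k y y)" "continuous_on X (\<lambda>y. k x y)"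
      using continuous_on_compose2[OF cont continuous_on_Pair[OF continuous_on_id continuous_on_id], of X]
        continuous_on_compose2[OF cont continuous_on_Pair[OF continuous_on_const continuous_on_id], of x X] x
      by auto
    then have "((\<lambda>y. k y y) \<longlongrightarrow> k x x) (at x within X)" "((\<lambda>y. k x y) \<longlongrightarrow> k x x) (at x within X)"
      using x by (auto simp: continuous_on_def)
    from tendsto_add[OF tendsto_diff[OF this(1) tendsto_mult_left[OF this(2), of 2]] tendsto_const]
    have "((\<lambda>y. k y y - 2 * k x y + k x x) \<longlongrightarrow> k x x - 2 * k x x + k x x) (at x within X)" .
    then have "((\<lambda>y. (d y)\<^sup>2) \<longlongrightarrow> 0) (at x within X)"
      by (simp add: d)
    from tendsto_real_sqrt[OF this] have "((\<lambda>y. \<bar>d y\<bar>) \<longlongrightarrow> 0) (at x within X)"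
      by simp
    then have d0: "(d \<longlongrightarrow> 0) (at x within X)"
      by (rule tendsto_rabs_zero_cancel)
    have "cmod (h y - h x) \<le> d y * rk_norm ip h" for y
      using Cauchy_Schwarz[OF diff_closed[OF kernel_section_closed kernel_section_closed] h, of y x]
        reproducing[OF h, of x] reproducing[OF h, of y]
      by (simp add: d_def ip_diff_left kernel_section_closed h)
    moreover have "((\<lambda>y. d y * rk_norm ip h) \<longlongrightarrow> 0) (at x within X)"
      using tendsto_mult_right[OF d0, of "rk_norm ip h"] by simp
    ultimately have "((\<lambda>y. h y - h x) \<longlongrightarrow> 0) (at x within X)"
      by (rule Lim_null_comparison[OF always_eventually[OF allI]])
    then show ?thesis by (simp add: LIM_zero_iff)
  qed
  then show ?thesis by (simp add: continuous_on_def)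
qed

section \<open>Interpolation in finite spans of kernel sections\<close>

lemma (in rkhs) sum_kernel_sections_closed:
  "finite S \<Longrightarrow> (\<lambda>y. \<Sum>s\<in>S. c s * kernel_section k s y) \<in> H"
  by (induction S rule: finite_induct)
    (auto intro!: zero_closed add_closed scale_closed kernel_section_closed)

lemma (in rkhs) kernel_span_subset: "finite S \<Longrightarrow> kernel_span k S \<subseteq> H"
  by (auto simp: kernel_span_def sum_kernel_sections_closed)

lemma (in rkhs) ip_sum_kernel_sections:
  "finite S \<Longrightarrow> g \<in> H \<Longrightarrow>
    ip g (\<lambda>y. \<Sum>s\<in>S. c s * kernel_section k s y) = (\<Sum>s\<in>S. c s * cnj (g s))"
proof (induction S rule: finite_induct)
  case empty
  then show ?case by (simp add: ip_zero)
next
  case (insert s S)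
  have "ip g (kernel_section k s) = cnj (g s)"
    using ip_commute[OF insert.prems kernel_section_closed, of s] reproducing[OF insert.prems, of s]
    by simp
  then show ?case
    using insert
    by (simp add: ip_add ip_scale scale_closed kernel_section_closed sum_kernel_sections_closed)
qed

text \<open>By the reproducing property, inner products with a span over \<open>S\<close> see only
  values on \<open>S\<close>. Uniqueness of interpolants and the Pythagorean identity both rest on
  this.\<close>

lemma (in rkhs) ip_kernel_span_eq_0:
  assumes "finite S" "h \<in> kernel_span k S" "g \<in> H" "\<And>s. s \<in> S \<Longrightarrow> g s = 0"
  shows "ip g h = 0"
  using assms by (auto simp: kernel_span_def ip_sum_kernel_sections)

lemma kernel_span_diff:
  assumes "f \<in> kernel_span k S" "g \<in> kernel_span k S"
  shows "(\<lambda>x. f x - g x) \<in> kernel_span k S"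
proof -
  obtain c d where "f = (\<lambda>y. \<Sum>s\<in>S. c s * kernel_section k s y)"
    and "g = (\<lambda>y. \<Sum>s\<in>S. d s * kernel_section k s y)"
    using assms by (auto simp: kernel_span_def)
  then have "(\<lambda>x. f x - g x) = (\<lambda>y. \<Sum>s\<in>S. (c s - d s) * kernel_section k s y)"
    by (simp add: sum_subtractf left_diff_distrib)
  then show ?thesis by (auto simp: kernel_span_def intro!: exI[of _ "\<lambda>s. c s - d s"])
qed

text \<open>The difference lies in the span and vanishes on \<open>S\<close>, so it is orthogonal to
  itself.\<close>

lemma (in rkhs) kernel_span_eqI:
  assumes "finite S" "f \<in> kernel_span k S" "g \<in> kernel_span k S" "\<And>s. s \<in> S \<Longrightarrow> f s = g s"
  shows "f = g"
proof -
  let ?d = "\<lambda>x. f x - g x"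
  have "?d \<in> kernel_span k S" by (rule kernel_span_diff[OF assms(2,3)])
  moreover from this have "?d \<in> H" using kernel_span_subset[OF assms(1)] by auto
  ultimately have "ip ?d ?d = 0" using assms by (intro ip_kernel_span_eq_0) auto
  then have "?d = (\<lambda>_. 0)" using ip_positive[OF \<open>?d \<in> H\<close>] by force
  then show ?thesis by (auto simp: fun_eq_iff)
qed

text \<open>Induction on \<open>S\<close>: when \<open>s\<close> is added, a function
  \<open>u\<close> in the enlarged span that vanishes on \<open>S\<close> but not at
  \<open>s\<close> corrects the old interpolant at \<open>s\<close> without disturbing it on
  \<open>S\<close>.\<close>

lemma (in rkhs) interpolant_exists:
  assumes spd: "strictly_positive_definite_on X k" and "finite S" "S \<subseteq> X"
  shows "\<exists>h\<in>kernel_span k S. \<forall>s\<in>S. h s = f s"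
  using assms(2,3)
proof (induction S arbitrary: f rule: finite_induct)
  case empty
  then show ?case by (auto simp: kernel_span_def)
next
  case (insert s S)
  obtain a where a: "\<And>t. t \<in> S \<Longrightarrow> (\<Sum>r\<in>S. a r * kernel_section k r t) = kernel_section k s t"
    using insert.IH[of "kernel_section k s"] insert.prems by (auto simp: kernel_span_def)
  obtain b where b: "\<And>t. t \<in> S \<Longrightarrow> (\<Sum>r\<in>S. b r * kernel_section k r t) = f t"
    using insert.IH[of f] insert.prems by (auto simp: kernel_span_def)
  \<comment> \<open>The coefficient -1 at \<open>s\<close> makes \<open>c\<close> nonzero, as strict
    positive definiteness demands; the coefficients \<open>a\<close> cancel the section at
    \<open>s\<close> on all of \<open>S\<close>.\<close>
  define c where "c = (\<lambda>r. if r = s then - 1 else a r)"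
  define u where "u = (\<lambda>y. \<Sum>r\<in>insert s S. c r * kernel_section k r y)"
  have ueq: "u y = (\<Sum>r\<in>S. a r * kernel_section k r y) - kernel_section k s y" for y
  proof -
    have "(\<Sum>r\<in>S. c r * kernel_section k r y) = (\<Sum>r\<in>S. a r * kernel_section k r y)"
      by (rule sum.cong) (use insert in \<open>auto simp: c_def\<close>)
    then show ?thesis using insert by (simp add: u_def c_def)
  qed
  have u0: "u t = 0" if "t \<in> S" for t using a[OF that] by (simp add: ueq)
  \<comment> \<open>The quadratic form of \<open>c\<close> pairs the conjugate coefficients with the
    values of \<open>u\<close>, so it would be 0 if \<open>u\<close> also vanished at
    \<open>s\<close>.\<close>
  have us: "u s \<noteq> 0"
  proof
    assume "u s = 0"
    then have z: "u t = 0" if "t \<in> insert s S" for t using u0 that by auto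
    have "0 < Re (\<Sum>x\<in>insert s S. \<Sum>y\<in>insert s S. cnj (c x) * c y * complex_of_real (k x y))"
    proof -
      have "finite (insert s S) \<and> insert s S \<subseteq> X \<and> (\<exists>y\<in>insert s S. c y \<noteq> 0)"
        using insert.hyps insert.prems by (auto simp: c_def)
      from spd[unfolded strictly_positive_definite_on_def Let_def, THEN spec[of _ "insert s S"],
          THEN spec[of _ c], THEN mp, OF this]
      show ?thesis by (rule conjunct2)
    qed
    moreover have "(\<Sum>x\<in>insert s S. \<Sum>y\<in>insert s S. cnj (c x) * c y * complex_of_real (k x y))
        = (\<Sum>x\<in>insert s S. cnj (c x) * u x)"
      unfolding u_def sum_distrib_left
      by (intro sum.cong refl) (subst kernel_symmetric, simp add: kernel_section_def)
    moreover have "\<dots> = 0" using z by (intro sum.neutral) auto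
    ultimately show False by simp
  qed
  \<comment> \<open>The error of the old interpolant at \<open>s\<close>, measured in units of
    \<open>u s\<close>.\<close>
  define v where "v = (f s - (\<Sum>r\<in>S. b r * kernel_section k r s)) / u s"
  define e where "e = (\<lambda>r. (if r = s then 0 else b r) + v * c r)"
  define h where "h = (\<lambda>y. \<Sum>r\<in>insert s S. e r * kernel_section k r y)"
  have h: "h y = (\<Sum>r\<in>S. b r * kernel_section k r y) + v * u y" for y
  proof -
    have "h y = (\<Sum>r\<in>insert s S. (if r = s then 0 else b r) * kernel_section k r y) + v * u y"
      unfolding h_def u_def sum_distrib_left sum.distrib[symmetric]
      by (intro sum.cong refl) (simp add: e_def algebra_simps)
    also have "(\<Sum>r\<in>insert s S. (if r = s then 0 else b r) * kernel_section k r y)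
        = (\<Sum>r\<in>S. b r * kernel_section k r y)"
    proof -
      have "(\<Sum>r\<in>S. (if r = s then 0 else b r) * kernel_section k r y)
          = (\<Sum>r\<in>S. b r * kernel_section k r y)"
        by (rule sum.cong) (use insert in auto)
      then show ?thesis using insert by simp
    qed
    finally show ?thesis .
  qed
  have "h t = f t" if "t \<in> insert s S" for t
  proof (cases "t = s")
    case True
    then show ?thesis using us by (simp add: h v_def)
  next
    case False
    then show ?thesis using that u0 b by (simp add: h)
  qed
  moreover have "h \<in> kernel_span k (insert s S)" unfolding h_def kernel_span_def by blast
  ultimately show ?case by blast
qed

text \<open>Existence comes from strict positive definiteness and uniqueness from orthogonality, so
  the \<open>THE\<close> in \<open>extension_operator\<close> denotes the intended function.\<close>

lemma (in rkhs)
  assumes "strictly_positive_definite_on X k" "finite S" "S \<subseteq> X"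
  shows extension_operator_in_span: "extension_operator k S f \<in> kernel_span k S"
    and extension_operator_interpolates: "s \<in> S \<Longrightarrow> extension_operator k S f s = f s"
proof -
  have "\<exists>!h. h \<in> kernel_span k S \<and> (\<forall>s\<in>S. h s = f s)"
    using interpolant_exists[OF assms, of f] kernel_span_eqI[OF assms(2)]
    by (intro ex_ex1I) (blast, metis)
  from theI'[OF this] show "extension_operator k S f \<in> kernel_span k S"
    and "s \<in> S \<Longrightarrow> extension_operator k S f s = f s"
    unfolding extension_operator_def by auto
qed

lemma (in rkhs) extension_operator_closed:
  assumes "strictly_positive_definite_on X k" "finite S" "S \<subseteq> X"
  shows "extension_operator k S f \<in> H"
  using extension_operator_in_span[OF assms] kernel_span_subset[OF assms(2)] by blast

section \<open>Energies of interpolants and extensions of least norm\<close>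

text \<open>The remainder \<open>g\<close> minus the interpolant vanishes on \<open>S\<close>, hence
  is orthogonal to the interpolant, which lies in the kernel span.\<close>

lemma (in rkhs) extension_energy_Pythagoras:
  assumes "strictly_positive_definite_on X k" "finite S" "S \<subseteq> X"
    and g: "is_extension H S f g"
  shows "(rk_norm ip g)\<^sup>2 =
    extension_energy ip k S f + (rk_norm ip (\<lambda>x. g x - extension_operator k S f x))\<^sup>2"
proof -
  let ?h = "extension_operator k S f"
  have gH: "g \<in> H" and gf: "\<And>s. s \<in> S \<Longrightarrow> g s = f s" using g by (auto simp: is_extension_def)
  have hH: "?h \<in> H" by (rule extension_operator_closed[OF assms(1-3)])
  have "ip (\<lambda>x. g x - ?h x) ?h = 0"
    by (rule ip_kernel_span_eq_0[OF assms(2) extension_operator_in_span[OF assms(1-3)]])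
      (auto simp: diff_closed gH hH gf extension_operator_interpolates[OF assms(1-3)])
  then have "ip g ?h = ip ?h ?h" by (simp add: ip_diff_left gH hH)
  then show ?thesis
    by (simp add: rk_norm_diff_power2 gH hH rk_norm_power2 extension_energy_def)
qed

lemma is_extension_mono: "is_extension H T f g \<Longrightarrow> S \<subseteq> T \<Longrightarrow> is_extension H S f g"
  by (auto simp: is_extension_def)

lemma (in rkhs) extension_energy_le:
  assumes "strictly_positive_definite_on X k" "finite S" "S \<subseteq> X" "is_extension H S f g"
  shows "extension_energy ip k S f \<le> (rk_norm ip g)\<^sup>2"
  using extension_energy_Pythagoras[OF assms] by simp

text \<open>Bounded evaluations turn norm convergence into pointwise convergence, where limits are
  unique.\<close>

lemma (in rkhs) eqI_rk_norm_limit: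
  assumes "g \<in> H" "h \<in> H" "\<And>n. F n \<in> H"
    and "(\<lambda>n. rk_norm ip (\<lambda>x. g x - F n x)) \<longlonglongrightarrow> 0"
    and "(\<lambda>n. rk_norm ip (\<lambda>x. h x - F n x)) \<longlonglongrightarrow> 0"
  shows "g = h"
proof
  fix x
  have lim: "(\<lambda>n. F n x) \<longlonglongrightarrow> f x"
    if f: "f \<in> H" and c: "(\<lambda>n. rk_norm ip (\<lambda>x. f x - F n x)) \<longlonglongrightarrow> 0" for f
  proof -
    have "(\<lambda>n. rk_norm ip (kernel_section k x) * rk_norm ip (\<lambda>x. f x - F n x)) \<longlonglongrightarrow> 0"
      using tendsto_mult_left[OF c, of "rk_norm ip (kernel_section k x)"] by simp
    then have "(\<lambda>n. f x - F n x) \<longlonglongrightarrow> 0"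
      by (rule Lim_null_comparison[rotated])
        (use norm_eval_le[OF diff_closed[OF f assms(3)]] in auto)
    from tendsto_diff[OF tendsto_const this, of "f x"] show ?thesis by simp
  qed
  show "g x = h x"
    using lim[OF assms(1,4)] lim[OF assms(2,5)] by (rule LIMSEQ_unique)
qed

text \<open>The interpolant on \<open>T\<close> is one particular extension from \<open>S\<close>,
  so its squared norm dominates the energy on \<open>S\<close>.\<close>

lemma (in rkhs) extension_energy_mono:
  assumes "strictly_positive_definite_on X k" "finite T" "S \<subseteq> T" "T \<subseteq> X"
  shows "extension_energy ip k S f \<le> extension_energy ip k T f"
proof -
  have "is_extension H S f (extension_operator k T f)"
    using extension_operator_closed[OF assms(1,2,4)]
      extension_operator_interpolates[OF assms(1,2,4)] assms(3)
    by (auto simp: is_extension_def)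
  then show ?thesis
    using extension_energy_le[of X S f] assms finite_subset[OF assms(3,2)]
    by (force simp: extension_energy_def)
qed

text \<open>Bounded increasing energies form a Cauchy sequence, Pythagoras transfers this to the
  interpolants, and completeness supplies the limit.\<close>

lemma (in rkhs) extension_if_energy_bounded:
  assumes spd: "strictly_positive_definite_on X k"
    and S: "incseq S" "\<And>N. finite (S N)" "\<And>N. S N \<subseteq> X"
    and bd: "\<And>N. extension_energy ip k (S N) f \<le> B"
  obtains h where "is_extension H (\<Union>N. S N) f h"
    "(\<lambda>N. rk_norm ip (\<lambda>x. h x - extension_operator k (S N) f x)) \<longlonglongrightarrow> 0"
proof -
  define F where "F N = extension_operator k (S N) f" for N
  define w where "w N = extension_energy ip k (S N) f" for N
  note spdS = spd S(2) S(3)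
  have FH: "F N \<in> H" for N unfolding F_def by (rule extension_operator_closed[OF spdS])
  have Ff: "F N s = f s" if "s \<in> S N" for N s
    unfolding F_def by (rule extension_operator_interpolates[OF spdS that])
  have SS: "S M \<subseteq> S N" if "M \<le> N" for M N using S(1) that by (auto simp: incseq_def)
  have mono: "incseq w"
    unfolding w_def incseq_def by (auto intro!: extension_energy_mono[OF spd S(2) SS S(3)])
  have "convergent w"
  proof -
    obtain L where "w \<longlonglongrightarrow> L"
      by (rule incseq_convergent[OF mono, of B]) (use bd in \<open>auto simp: w_def\<close>)
    then show ?thesis by (rule convergentI)
  qed
  then have "Cauchy w" by (rule convergent_Cauchy)
  \<comment> \<open>\<open>F N\<close> extends \<open>f\<close> from the smaller set
    \<open>S M\<close>, so the squared distance of two interpolants is a difference of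
    energies.\<close>
  have d: "(rk_norm ip (\<lambda>x. F N x - F M x))\<^sup>2 = w N - w M" if "M \<le> N" for M N
  proof -
    have "is_extension H (S M) f (F N)" using SS[OF that] FH Ff by (auto simp: is_extension_def)
    from extension_energy_Pythagoras[OF spdS this] show ?thesis
      by (simp add: w_def F_def extension_energy_def)
  qed
  \<comment> \<open>The identity \<open>d\<close> orders its indices, whereas the Cauchy condition
    does not.\<close>
  have sym: "rk_norm ip (\<lambda>x. a x - b x) = rk_norm ip (\<lambda>x. b x - a x)" if "a \<in> H" "b \<in> H" for a b
  proof -
    have "(rk_norm ip (\<lambda>x. a x - b x))\<^sup>2 = (rk_norm ip (\<lambda>x. b x - a x))\<^sup>2"
      using ip_commute[OF that] by (simp add: rk_norm_diff_power2 that)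
    then show ?thesis by (simp add: rk_norm_nonneg diff_closed that)
  qed
  have "\<exists>h\<in>H. (\<lambda>n. rk_norm ip (\<lambda>x. F n x - h x)) \<longlonglongrightarrow> 0"
  proof (rule complete[OF FH])
    fix e :: real assume e: "0 < e"
    then obtain N0 where N0: "\<And>m n. m \<ge> N0 \<Longrightarrow> n \<ge> N0 \<Longrightarrow> \<bar>w m - w n\<bar> < e\<^sup>2"
      using \<open>Cauchy w\<close> unfolding Cauchy_def dist_real_def by (meson zero_less_power)
    have lt: "rk_norm ip (\<lambda>x. F m x - F n x) < e" if "m \<ge> n" "n \<ge> N0" for m n
      using d[OF that(1)] N0[of m n] that e by (intro power2_less_imp_less[of _ e]) auto
    have "rk_norm ip (\<lambda>x. F m x - F n x) < e" if "m \<ge> N0" "n \<ge> N0" for m n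
      using lt[of n m] lt[of m n] that sym[OF FH FH, of m n] by (cases "m \<ge> n") auto
    then show "\<exists>N. \<forall>m\<ge>N. \<forall>n\<ge>N. rk_norm ip (\<lambda>x. F m x - F n x) < e" by blast
  qed
  then obtain h where h: "h \<in> H" "(\<lambda>n. rk_norm ip (\<lambda>x. F n x - h x)) \<longlonglongrightarrow> 0" by blast
  have conv: "(\<lambda>n. rk_norm ip (\<lambda>x. h x - F n x)) \<longlonglongrightarrow> 0"
    using h(2) sym[OF FH h(1)] by simp
  \<comment> \<open>From index \<open>M\<close> on, \<open>F n s\<close> equals \<open>f s\<close>,
    so boundedness of evaluation at \<open>s\<close> passes the interpolation condition to the
    limit.\<close>
  have "h s = f s" if s: "s \<in> S M" for s M
  proof -
    have "(\<lambda>n. rk_norm ip (kernel_section k s) * rk_norm ip (\<lambda>x. h x - F n x)) \<longlonglongrightarrow> 0"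
      using tendsto_mult_left[OF conv, of "rk_norm ip (kernel_section k s)"] by simp
    moreover have "eventually (\<lambda>n. cmod (h s - f s) \<le>
        rk_norm ip (kernel_section k s) * rk_norm ip (\<lambda>x. h x - F n x)) sequentially"
      using eventually_ge_at_top[of M]
    proof eventually_elim
      case (elim n)
      then have "F n s = f s" using SS[of M n] s Ff by blast
      then show ?case using norm_eval_le[OF diff_closed[OF h(1) FH], of s n] by simp
    qed
    ultimately have "cmod (h s - f s) \<le> 0"
      by (intro tendsto_lowerbound[of _ 0 sequentially]) auto
    then show ?thesis by simp
  qed
  then have "is_extension H (\<Union>N. S N) f h" using h(1) by (auto simp: is_extension_def)
  then show ?thesis using that conv by (simp add: F_def)
qed

text \<open>Increasing energies tend to infinity unless they are bounded; an extension bounds them,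
  and bounded energies produce an extension.\<close>

lemma (in rkhs) extension_energy_at_top_iff:
  assumes spd: "strictly_positive_definite_on X k"
    and S: "incseq S" "\<And>N. finite (S N)" "\<And>N. S N \<subseteq> X"
  shows "filterlim (\<lambda>N. extension_energy ip k (S N) f) at_top sequentially \<longleftrightarrow>
    \<not> (\<exists>h. is_extension H (\<Union>N. S N) f h)"
proof
  assume lim: "filterlim (\<lambda>N. extension_energy ip k (S N) f) at_top sequentially"
  show "\<not> (\<exists>h. is_extension H (\<Union>N. S N) f h)"
  proof
    assume "\<exists>h. is_extension H (\<Union>N. S N) f h"
    then obtain h where h: "is_extension H (\<Union>N. S N) f h" by blast
    have le: "extension_energy ip k (S N) f \<le> (rk_norm ip h)\<^sup>2" for N
      by (rule extension_energy_le[OF spd S(2,3) is_extension_mono[OF h]]) auto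
    have "eventually (\<lambda>N. (rk_norm ip h)\<^sup>2 + 1 \<le> extension_energy ip k (S N) f) sequentially"
      using lim by (simp add: filterlim_at_top)
    then obtain N where "(rk_norm ip h)\<^sup>2 + 1 \<le> extension_energy ip k (S N) f"
      by (auto simp: eventually_sequentially)
    with le[of N] show False by simp
  qed
next
  assume no: "\<not> (\<exists>h. is_extension H (\<Union>N. S N) f h)"
  show "filterlim (\<lambda>N. extension_energy ip k (S N) f) at_top sequentially"
    unfolding filterlim_at_top
  proof
    fix B
    obtain M where M: "B < extension_energy ip k (S M) f"
      using extension_if_energy_bounded[OF assms, of f B] no by (meson not_le)
    have "extension_energy ip k (S M) f \<le> extension_energy ip k (S N) f" if "M \<le> N" for N
      using S(1) that by (intro extension_energy_mono[OF spd S(2) _ S(3)]) (auto simp: incseq_def)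
    then show "eventually (\<lambda>N. B \<le> extension_energy ip k (S N) f) sequentially"
      using M unfolding eventually_sequentially by (meson less_imp_le order_trans)
  qed
qed

text \<open>The squared norm of the limit of the interpolants is the limit of the energies, a lower
  bound for every extension. A second minimiser has the same norm, so its Pythagorean remainder
  tends to 0 and the interpolants converge to it as well.\<close>

lemma (in rkhs) minimal_extension:
  assumes spd: "strictly_positive_definite_on X k"
    and S: "incseq S" "\<And>N. finite (S N)" "\<And>N. S N \<subseteq> X"
    and ex: "\<exists>h. is_extension H (\<Union>N. S N) f h"
  shows "\<exists>!h. is_minimal_extension H ip (\<Union>N. S N) f h"
    and "is_minimal_extension H ip (\<Union>N. S N) f g \<Longrightarrow>
      (\<lambda>N. extension_energy ip k (S N) f) \<longlonglongrightarrow> (rk_norm ip g)\<^sup>2"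
proof -
  let ?S = "\<Union>N. S N"
  let ?F = "\<lambda>N. extension_operator k (S N) f"
  let ?w = "\<lambda>N. extension_energy ip k (S N) f"
  have le: "?w N \<le> (rk_norm ip g)\<^sup>2" if g: "is_extension H ?S f g" for g N
    by (rule extension_energy_le[OF spd S(2,3) is_extension_mono[OF g]]) auto
  obtain h where h: "is_extension H ?S f h" "(\<lambda>N. rk_norm ip (\<lambda>x. h x - ?F N x)) \<longlonglongrightarrow> 0"
  proof -
    obtain g where "is_extension H ?S f g" using ex by blast
    from extension_if_energy_bounded[OF spd S le[OF this]] that show ?thesis by blast
  qed
  have pyth: "?w N = (rk_norm ip g)\<^sup>2 - (rk_norm ip (\<lambda>x. g x - ?F N x))\<^sup>2"
    if g: "is_extension H ?S f g" for g N
    using extension_energy_Pythagoras[OF spd S(2,3) is_extension_mono[OF g UN_upper[OF UNIV_I]], of N]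
    by simp
  have lim: "?w \<longlonglongrightarrow> (rk_norm ip h)\<^sup>2"
    using tendsto_diff[OF tendsto_const tendsto_power[OF h(2), of 2], of "(rk_norm ip h)\<^sup>2"]
    by (simp add: pyth[OF h(1)])
  have min: "is_minimal_extension H ip ?S f h"
    unfolding is_minimal_extension_def
  proof (intro conjI h(1) allI impI)
    fix g assume g: "is_extension H ?S f g"
    have "(rk_norm ip h)\<^sup>2 \<le> (rk_norm ip g)\<^sup>2"
      by (rule tendsto_upperbound[OF lim]) (use le[OF g] in auto)
    then show "rk_norm ip h \<le> rk_norm ip g"
      by (rule power2_le_imp_le) (use g in \<open>auto simp: rk_norm_nonneg is_extension_def\<close>)
  qed
  have uniq: "g = h" if g: "is_minimal_extension H ip ?S f g" for g
  proof -
    have ge: "is_extension H ?S f g" using g by (simp add: is_minimal_extension_def)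
    have eq: "rk_norm ip g = rk_norm ip h"
      using g h(1) ge min unfolding is_minimal_extension_def by (meson antisym)
    have "(\<lambda>N. sqrt ((rk_norm ip g)\<^sup>2 - ?w N)) \<longlonglongrightarrow> sqrt ((rk_norm ip g)\<^sup>2 - (rk_norm ip h)\<^sup>2)"
      by (rule tendsto_real_sqrt[OF tendsto_diff[OF tendsto_const lim]])
    moreover have "sqrt ((rk_norm ip g)\<^sup>2 - ?w N) = rk_norm ip (\<lambda>x. g x - ?F N x)" for N
      using ge unfolding pyth[OF ge, of N]
      by (simp add: rk_norm_nonneg diff_closed is_extension_def extension_operator_closed[OF spd S(2,3)])
    ultimately have "(\<lambda>N. rk_norm ip (\<lambda>x. g x - ?F N x)) \<longlonglongrightarrow> 0" by (simp add: eq)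
    from eqI_rk_norm_limit[OF _ _ extension_operator_closed[OF spd S(2,3)] this h(2)] ge h(1)
    show ?thesis by (simp add: is_extension_def)
  qed
  show "\<exists>!h. is_minimal_extension H ip ?S f h"
    by (rule ex1I, rule min, rule uniq)
  show "?w \<longlonglongrightarrow> (rk_norm ip g)\<^sup>2" if "is_minimal_extension H ip ?S f g"
    using uniq[OF that] lim by simp
qed

subsection \<open>Continuous characters of the real line\<close>

lemma has_vector_derivative_zero_unique:
  assumes "convex S" "\<And>x. x \<in> S \<Longrightarrow> (f has_vector_derivative 0) (at x within S)"
    and "x \<in> S" "y \<in> S"
  shows "f x = f y"
  using assms(2) by (intro has_derivative_zero_unique[OF assms(1) _ assms(3,4)])
    (simp add: has_vector_derivative_def)

text \<open>Continuity gives an antiderivative \<open>G\<close>, and multiplicativity expresses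
  \<open>c\<close> through increments of \<open>G\<close>, so \<open>c\<close> is differentiable
  near 0. Then \<open>c\<close> solves a linear differential equation, hence is an exponential, and
  unit modulus makes its exponent imaginary.\<close>

lemma continuous_character_eq_cis:
  fixes c :: "real \<Rightarrow> complex"
  assumes cont: "continuous_on UNIV c" and mult: "\<And>s t. c (s + t) = c s * c t"
    and norm: "\<And>t. cmod (c t) = 1"
  obtains \<beta> where "\<And>t. c t = cis (\<beta> * t)"
proof -
  have nz: "c t \<noteq> 0" for t using norm[of t] by auto
  have c0: "c 0 = 1" using mult[of 0 0] nz[of 0] by simp
  \<comment> \<open>This interval leaves room for \<open>t + s\<close> with \<open>t\<close>
    strictly between -1 and 1 and \<open>s\<close> between 0 and some \<open>a < 1\<close>.\<close>
  obtain G where G: "\<And>x. x \<in> {-1..2} \<Longrightarrow> (G has_vector_derivative c x) (at x within {-1..2})"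
    using antiderivative_continuous[of "-1" 2 c] continuous_on_subset[OF cont] by blast
  have G': "(G has_vector_derivative c x) (at x)" if "-1 < x" "x < 2" for x
    using G[of x] at_within_Icc_at[OF that] that by simp
  \<comment> \<open>Otherwise \<open>G\<close> would be constant on a right neighbourhood of 0,
    against its derivative \<open>c 0 = 1\<close> there.\<close>
  have "\<exists>a. 0 < a \<and> a < 1 \<and> G a \<noteq> G 0"
  proof (rule ccontr)
    assume no: "\<not> ?thesis"
    have "G x = G 0" if "x \<in> {0..1/2}" for x
      using no that by (cases "x = 0") force+
    then have "(G has_vector_derivative 0) (at 0 within {0..1/2})"
      by (rule has_vector_derivative_transform[OF _ _ has_vector_derivative_const[of "G 0"], rotated]) auto
    moreover have "(G has_vector_derivative c 0) (at 0 within {0..1/2})"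
      by (rule has_vector_derivative_at_within) (rule G', auto)
    ultimately have "0 = c 0"
      by (intro vector_derivative_unique_within_closed_interval[of 0 "1/2" 0 G]) auto
    then show False using c0 by simp
  qed
  then obtain a where a: "0 < a" "a < 1" "G a \<noteq> G 0" by blast
  \<comment> \<open>For fixed \<open>t\<close> the derivative of
    \<open>G (t + s) - c t * G s\<close> in \<open>s\<close> is 0 by multiplicativity; compare the
    values at \<open>s = a\<close> and \<open>s = 0\<close>.\<close>
  have eq: "c t = (G (t + a) - G t) / (G a - G 0)" if t: "-1 < t" "t < 1" for t
  proof -
    have "((\<lambda>s. G (t + s) - c t * G s) has_vector_derivative 0) (at s within {0..a})"
      if "s \<in> {0..a}" for s
    proof -
      have "((\<lambda>s. t + s) has_vector_derivative 1) (at s)"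
        by (auto intro!: derivative_eq_intros)
      from vector_diff_chain_at[OF this, of G "c (t + s)"] G'[of "t + s"]
      have "((\<lambda>s. G (t + s)) has_vector_derivative c (t + s)) (at s)"
        using t that a by (simp add: comp_def)
      moreover have "((\<lambda>s. c t * G s) has_vector_derivative c t * c s) (at s)"
        using G'[of s] t that a by (intro has_vector_derivative_mult_right) auto
      ultimately have "((\<lambda>s. G (t + s) - c t * G s) has_vector_derivative c (t + s) - c t * c s) (at s)"
        by (rule has_vector_derivative_diff)
      then show ?thesis by (simp add: mult has_vector_derivative_at_within)
    qed
    from has_vector_derivative_zero_unique[OF convex_real_interval(5) this, of a 0]
    have "G (t + a) - c t * G a = G (t + 0) - c t * G 0"
      using a by simp
    then show ?thesis using a by (simp add: field_simps)
  qed
  \<comment> \<open>The derivative of the right side of \<open>eq\<close> at 0, since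
    \<open>G\<close> has derivative \<open>c\<close>.\<close>
  define l where "l = (c a - c 0) / (G a - G 0)"
  have l: "(c has_vector_derivative l) (at 0)"
  proof -
    have "((\<lambda>s. s + a) has_vector_derivative 1) (at 0)"
      by (auto intro!: derivative_eq_intros)
    from vector_diff_chain_at[OF this, of G "c a"] G'[of a]
    have "((\<lambda>s. G (s + a)) has_vector_derivative c a) (at 0)"
      using a by (simp add: comp_def)
    then have "((\<lambda>s. (G (s + a) - G s) / (G a - G 0)) has_vector_derivative l) (at 0)"
      unfolding l_def by (intro has_vector_derivative_divide has_vector_derivative_diff G') auto
    then show ?thesis
      by (rule has_vector_derivative_transform_within_open[where S = "{-1<..<1}"]) (auto simp: eq)
  qed
  \<comment> \<open>The derivative at 0 is carried to \<open>t\<close> by writing \<open>c s\<close>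
    as \<open>c t * c (s - t)\<close>.\<close>
  have der: "(c has_vector_derivative c t * l) (at t)" for t
  proof -
    have "((\<lambda>s. s - t) has_vector_derivative 1) (at t)"
      by (auto intro!: derivative_eq_intros)
    from vector_diff_chain_at[OF this, of c l] l
    have "((\<lambda>s. c (s - t)) has_vector_derivative l) (at t)"
      by (simp add: comp_def)
    then have "((\<lambda>s. c t * c (s - t)) has_vector_derivative c t * l) (at t)"
      by (rule has_vector_derivative_mult_right)
    then show ?thesis by (simp flip: mult)
  qed
  \<comment> \<open>An integrating factor: the product is constant and has the value 1 at 0.\<close>
  have "((\<lambda>t. c t * exp (t *\<^sub>R (- l))) has_vector_derivative 0) (at t within UNIV)" for t
    using has_vector_derivative_mult[OF der exp_scaleR_has_vector_derivative_right[of "-l" t]]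
    by (simp add: algebra_simps)
  from has_vector_derivative_zero_unique[OF convex_UNIV this, of _ 0]
  have "c t * exp (t *\<^sub>R (- l)) = 1" for t
    using c0 by simp
  then have ct: "c t = exp (t *\<^sub>R l)" for t
    by (simp add: exp_minus field_simps)
  have "Re l = 0" using norm[of 1] ct[of 1] by simp
  then have "t *\<^sub>R l = \<i> * of_real (Im l * t)" for t by (simp add: complex_eq_iff)
  then have "c t = cis (Im l * t)" for t by (simp add: ct cis_conv_exp)
  then show ?thesis using that by blast
qed

subsection \<open>Density of sampled orbits\<close>

text \<open>Only the dynamics is collected here; functions from the RKHS enter the lemmas of this
  locale solely through their continuity on \<open>X\<close>.\<close>

locale ergodic_sampled_flow =
  fixes \<Phi> :: "real \<Rightarrow> 'a::metric_space \<Rightarrow> 'a" and \<mu> :: "'a measure" and X :: "'a set" and \<Delta>t :: real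
  assumes flow: "continuous_flow \<Phi>"
    and prob: "prob_space \<mu>"
    and sets_eq: "sets \<mu> = sets borel"
    and invariant: "invariant_measure \<mu> \<Phi>"
    and support: "is_support \<mu> X"
    and compact_support: "compact X"
    and not_fixed_point: "\<not> (\<exists>p. X = {p} \<and> (\<forall>t. \<Phi> t p = p))"
    and step_pos: "\<Delta>t > 0"
    and ergodic: "ergodic_measure \<mu> (\<lambda>n::int. \<Phi> (of_int n * \<Delta>t))"

sublocale ergodic_sampled_flow \<subseteq> prob_space \<mu>
  by (rule prob)

context ergodic_sampled_flow
begin

abbreviation orb :: "'a \<Rightarrow> int \<Rightarrow> 'a" where
  "orb \<equiv> sampled_orbit \<Phi> \<Delta>t"

section \<open>Basic properties of the flow, its invariant measure and the support\<close>

lemma space_eq: "space \<mu> = UNIV"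
  using sets_eq_imp_space_eq[OF sets_eq] by simp

lemma flow_0: "\<Phi> 0 x = x" and flow_add: "\<Phi> (s + t) x = \<Phi> s (\<Phi> t x)"
  using flow by (auto simp: continuous_flow_def)

lemma continuous_on_flow: "continuous_on UNIV (\<Phi> t)"
proof -
  have "continuous_on UNIV (\<lambda>(t, x). \<Phi> t x)" using flow by (simp add: continuous_flow_def)
  from continuous_on_compose2[OF this continuous_on_Pair[OF continuous_on_const continuous_on_id], of t UNIV]
  show ?thesis by (simp add: id_def)
qed

lemma continuous_on_orbit: "continuous_on UNIV (\<lambda>t. \<Phi> t x)"
proof -
  have "continuous_on UNIV (\<lambda>(t, x). \<Phi> t x)" using flow by (simp add: continuous_flow_def)
  from continuous_on_compose2[OF this continuous_on_Pair[OF continuous_on_id continuous_on_const], of x UNIV]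
  show ?thesis by simp
qed

lemma measurable_flow: "\<Phi> t \<in> measurable \<mu> \<mu>"
  using invariant by (auto simp: invariant_measure_def)

lemma emeasure_vimage_flow:
  assumes "A \<in> sets \<mu>"
  shows "emeasure \<mu> (\<Phi> t -` A) = emeasure \<mu> A"
proof -
  have "emeasure \<mu> A = emeasure (distr \<mu> \<mu> (\<Phi> t)) A"
    using invariant by (simp add: invariant_measure_def)
  also have "\<dots> = emeasure \<mu> (\<Phi> t -` A)"
    using emeasure_distr[OF measurable_flow assms, of t] by (simp add: space_eq)
  finally show ?thesis by simp
qed

lemma closed_X: "closed X"
  using support by (simp add: is_support_def)

lemma null_compl_X: "emeasure \<mu> (- X) = 0"
  using support by (simp add: is_support_def)

lemma X_subset: "closed C \<Longrightarrow> emeasure \<mu> (- C) = 0 \<Longrightarrow> X \<subseteq> C"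
  using support by (simp add: is_support_def)

lemma AE_in_X: "AE x in \<mu>. x \<in> X"
  by (rule AE_I[of _ _ "- X"]) (auto simp: null_compl_X sets_eq closed_X)

text \<open>The preimage of \<open>X\<close> is closed and of full measure, so minimality of the
  support puts \<open>X\<close> inside it.\<close>

lemma flow_X: "x \<in> X \<Longrightarrow> \<Phi> t x \<in> X"
proof -
  have "closed (\<Phi> t -` X)"
    using continuous_closed_vimage[OF closed_X] continuous_on_flow
    by (auto simp: continuous_on_eq_continuous_at)
  moreover have "emeasure \<mu> (- (\<Phi> t -` X)) = 0"
    using emeasure_vimage_flow[of "- X" t] null_compl_X closed_X by (simp add: sets_eq vimage_Compl)
  ultimately have "X \<subseteq> \<Phi> t -` X" by (rule X_subset)
  then show "x \<in> X \<Longrightarrow> \<Phi> t x \<in> X" by auto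
qed

section \<open>Recurrence, density and injectivity of sampled orbits\<close>

lemma flow_orb: "\<Phi> (of_int m * \<Delta>t) (orb x n) = orb x (m + n)"
  by (simp add: sampled_orbit_def algebra_simps flip: flow_add)

lemma orb_flow: "orb (\<Phi> (of_int m * \<Delta>t) x) n = orb x (m + n)"
  by (simp add: sampled_orbit_def algebra_simps flip: flow_add)

lemma orb_0: "orb x 0 = x"
  by (simp add: sampled_orbit_def flow_0)

lemma orb_in_X: "x \<in> X \<Longrightarrow> orb x n \<in> X"
  by (simp add: sampled_orbit_def flow_X)

text \<open>The sets \<open>B m\<close> of points whose orbit meets \<open>U\<close> after time \<open>m\<close> are decreasing and preimages of
  each other, so their intersection, which is invariant, has the measure of \<open>B 0 \<supseteq> U\<close>.\<close>

lemma AE_orbit_meets_open: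
  assumes U: "open U" "emeasure \<mu> U \<noteq> 0"
  shows "AE x in \<mu>. \<exists>n::nat. orb x (int n) \<in> U"
proof -
  define B where "B m = {x. \<exists>n\<ge>m. orb x n \<in> U}" for m :: int
  have shift: "\<Phi> (of_int i * \<Delta>t) -` B m = B (i + m)" for i m
  proof -
    have "(\<exists>n\<ge>m. orb x (i + n) \<in> U) \<longleftrightarrow> (\<exists>n\<ge>i + m. orb x n \<in> U)" (is "?l \<longleftrightarrow> ?r") for x
    proof
      assume ?l
      then obtain n where "n \<ge> m" "orb x (i + n) \<in> U" by blast
      then show ?r by (intro exI[of _ "i + n"]) simp
    next
      assume ?r
      then obtain n where "n \<ge> i + m" "orb x n \<in> U" by blast
      then show ?l by (intro exI[of _ "n - i"]) simp
    qed
    then show ?thesis by (auto simp: B_def orb_flow)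
  qed
  have open_B: "open (B m)" for m
  proof -
    have "B m = (\<Union>n\<in>{m..}. \<Phi> (of_int n * \<Delta>t) -` U)"
      by (auto simp: B_def sampled_orbit_def)
    then show ?thesis
      using U(1) continuous_on_flow by (auto intro!: open_vimage)
  qed
  have B_sets: "B m \<in> sets \<mu>" for m using open_B by (simp add: sets_eq)
  have B_measure: "measure \<mu> (B m) = measure \<mu> (B 0)" for m
    using emeasure_vimage_flow[OF B_sets, of "of_int m * \<Delta>t" 0] shift[of m 0] by (simp add: measure_def)
  define A where "A = (\<Inter>m::nat. B (int m))"
  \<comment> \<open>The sets decrease, so all integers may serve as indices. Natural indices suit
    continuity of the measure; with integers a shift merely reindexes the intersection.\<close>
  have A_alt: "A = (\<Inter>m::int. B m)"
  proof -
    have "B (int (nat m)) \<subseteq> B m" for m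
    proof
      fix x assume "x \<in> B (int (nat m))"
      then obtain n where "n \<ge> int (nat m)" "orb x n \<in> U" by (auto simp: B_def)
      moreover from this have "n \<ge> m" by linarith
      ultimately show "x \<in> B m" unfolding B_def by blast
    qed
    then show ?thesis unfolding A_def by blast
  qed
  have "B (int n) \<subseteq> B (int m)" if "m \<le> n" for m n
  proof
    fix x assume "x \<in> B (int n)"
    then obtain j where "j \<ge> int n" "orb x j \<in> U" by (auto simp: B_def)
    then have "j \<ge> int m \<and> orb x j \<in> U" using that by auto
    then show "x \<in> B (int m)" unfolding B_def by blast
  qed
  then have "decseq (\<lambda>m::nat. B (int m))" by (simp add: decseq_def)
  then have "(\<lambda>m::nat. measure \<mu> (B (int m))) \<longlonglongrightarrow> measure \<mu> A"
    unfolding A_def using B_sets by (intro finite_Lim_measure_decseq) auto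
  then have "(\<lambda>m::nat. measure \<mu> (B 0)) \<longlonglongrightarrow> measure \<mu> A"
    by (subst (asm) B_measure)
  then have mA: "measure \<mu> A = measure \<mu> (B 0)"
    by (simp add: LIMSEQ_const_iff)
  have "U \<subseteq> B 0" by (auto simp: B_def orb_0 intro!: exI[of _ 0])
  then have "measure \<mu> U \<le> measure \<mu> A"
    unfolding mA using B_sets by (rule finite_measure_mono)
  moreover have "0 < measure \<mu> U"
    using U(2) by (simp add: emeasure_eq_measure zero_less_measure_iff)
  ultimately have "measure \<mu> A \<noteq> 0" by linarith
  moreover have "A \<in> sets \<mu>" unfolding A_def using B_sets by auto
  moreover have "\<Phi> (of_int i * \<Delta>t) -` A \<inter> space \<mu> = A" for i
  proof -
    have "\<Phi> (of_int i * \<Delta>t) -` A = (\<Inter>m. B (i + m))"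
      unfolding A_alt vimage_INT shift ..
    also have "\<dots> = A"
    proof (intro equalityI subsetI)
      fix x assume x: "x \<in> (\<Inter>m. B (i + m))"
      have "x \<in> B m" for m using INT_D[OF x, of "m - i"] by simp
      then show "x \<in> A" unfolding A_alt by blast
    qed (auto simp: A_alt)
    finally show ?thesis by (simp add: space_eq)
  qed
  ultimately have "measure \<mu> A = 1"
    using ergodic unfolding ergodic_measure_def by blast
  then have "AE x in \<mu>. x \<in> A" by (rule AE_prob_1)
  then show ?thesis
  proof eventually_elim
    case (elim x)
    then have "x \<in> B 0" unfolding A_alt by blast
    then obtain n where "n \<ge> 0" "orb x n \<in> U" by (auto simp: B_def)
    then show ?case by (intro exI[of _ "nat n"]) simp
  qed
qed

text \<open>Total boundedness of \<open>X\<close> provides countably many balls with centres in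
  \<open>X\<close> that detect density; almost every forward orbit meets all of them.\<close>

lemma AE_orbit_dense: "AE x in \<mu>. X \<subseteq> closure (range (\<lambda>n::nat. orb x (int n)))"
proof -
  have "\<exists>K. finite K \<and> K \<subseteq> X \<and> X \<subseteq> (\<Union>y\<in>K. ball y (inverse (Suc m)))" for m
    using seq_compact_imp_totally_bounded[of X] compact_support
    by (auto simp: compact_eq_seq_compact_metric)
  then obtain K where K: "\<And>m. finite (K m)" "\<And>m. K m \<subseteq> X"
      "\<And>m. X \<subseteq> (\<Union>y\<in>K m. ball y (inverse (Suc m)))"
    by metis
  \<comment> \<open>The complement of a null ball would be a closed set of full measure missing the
    centre \<open>y\<close> of \<open>X\<close>.\<close>
  have pos: "emeasure \<mu> (ball y r) \<noteq> 0" if "y \<in> X" "r > 0" for y r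
  proof
    assume "emeasure \<mu> (ball y r) = 0"
    then have "X \<subseteq> - ball y r" by (intro X_subset) auto
    then show False using that by auto
  qed
  have "AE x in \<mu>. \<forall>m. \<forall>y\<in>K m. \<exists>n::nat. orb x (int n) \<in> ball y (inverse (Suc m))"
    unfolding AE_all_countable
  proof
    fix m
    show "AE x in \<mu>. \<forall>y\<in>K m. \<exists>n::nat. orb x (int n) \<in> ball y (inverse (Suc m))"
      using K(1)[of m] by (rule AE_finite_allI) (use K(2)[of m] pos in \<open>auto intro!: AE_orbit_meets_open simp del: mem_ball\<close>)
  qed
  then show ?thesis
  proof eventually_elim
    case (elim x)
    show ?case
    proof
      fix z assume z: "z \<in> X"
      show "z \<in> closure (range (\<lambda>n::nat. orb x (int n)))"
        unfolding closure_approachable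
      proof (intro allI impI)
        fix e :: real assume "e > 0"
        \<comment> \<open>Half of \<open>e\<close>, because \<open>z\<close> and the orbit point are
          compared through a common centre \<open>y\<close>.\<close>
        then obtain m where m: "inverse (Suc m) < e / 2"
          using reals_Archimedean[of "e / 2"] by auto
        obtain y where y: "y \<in> K m" "dist y z < inverse (Suc m)"
          using K(3)[of m] z by auto
        obtain n :: nat where n: "dist y (orb x (int n)) < inverse (Suc m)"
          using elim y(1) by auto
        have "dist (orb x (int n)) z < e"
          using dist_triangle2[of "orb x (int n)" z y] y(2) n m
            dist_triangle3[of "orb x (int n)" z y] by linarith
        then show "\<exists>w\<in>range (\<lambda>n::nat. orb x (int n)). dist w z < e" by blast
      qed
    qed
  qed
qed

text \<open>A periodic dense orbit would make \<open>X\<close> finite, and then the flow could not move its points.\<close>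

lemma inj_orbit:
  assumes x: "x \<in> X" and dense: "X \<subseteq> closure (range (\<lambda>n::nat. orb x (int n)))"
  shows "inj (orb x)"
proof (rule ccontr)
  assume "\<not> inj (orb x)"
  then obtain a b where ab: "a < b" "orb x a = orb x b"
    unfolding inj_def by (metis linorder_less_linear)
  define p where "p = b - a"
  have p: "p > 0" using ab by (simp add: p_def)
  \<comment> \<open>Flowing back by \<open>a\<close> steps moves the coincidence of orbit points to
    \<open>x\<close> itself.\<close>
  have px: "orb x p = x"
    using flow_orb[of "- a" x a] flow_orb[of "- a" x b] ab by (simp add: p_def orb_0)
  then have per: "orb x (n + p) = orb x n" for n
    using flow_orb[of n x p] by (simp add: sampled_orbit_def)
  have per': "orb x (int k * p + n) = orb x n" for k n
  proof (induction k)
    case (Suc k)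
    then show ?case using per[of "int k * p + n"] by (simp add: algebra_simps)
  qed simp
  have "range (\<lambda>n::nat. orb x (int n)) \<subseteq> orb x ` {0..<p}"
  proof clarify
    fix n :: nat
    have "orb x (int n) = orb x (int (nat (int n div p)) * p + int n mod p)"
      using p by (simp add: pos_imp_zdiv_nonneg_iff)
    also have "\<dots> = orb x (int n mod p)" by (rule per')
    finally show "orb x (int n) \<in> orb x ` {0..<p}" using p by auto
  qed
  then have fin: "finite (range (\<lambda>n::nat. orb x (int n)))" by (rule finite_subset) simp
  then have finX: "finite X"
    using dense finite_imp_closed[OF fin] finite_subset by (metis closure_closed)
  \<comment> \<open>The distance to \<open>x\<close> along the flow is continuous on the connected
    line and takes finitely many values, so it keeps its value 0 from time 0.\<close>
  have fixed: "\<Phi> t x = x" for t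
  proof -
    have "(\<lambda>t. dist (\<Phi> t x) x) constant_on UNIV"
    proof (rule continuous_finite_range_constant)
      show "continuous_on UNIV (\<lambda>t. dist (\<Phi> t x) x)"
        by (intro continuous_on_dist continuous_on_orbit continuous_on_const)
      have "range (\<lambda>t. dist (\<Phi> t x) x) \<subseteq> (\<lambda>y. dist y x) ` X"
        using flow_X[OF x] by auto
      then show "finite (range (\<lambda>t. dist (\<Phi> t x) x))"
        using finX finite_surj by blast
    qed simp
    then obtain c where "\<And>t. dist (\<Phi> t x) x = c" unfolding constant_on_def by auto
    from this[of t] this[of 0] show ?thesis by (simp add: flow_0)
  qed
  have "X \<subseteq> {x}" using dense by (simp add: sampled_orbit_def fixed)
  then have "X = {x}" using x by auto
  with not_fixed_point fixed show False by blast
qed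

text \<open>The set of agreement is closed because \<open>X\<close> is closed, and it contains the
  dense forward orbit. Identities between continuous functions are transferred to \<open>X\<close>
  in this way.\<close>

lemma eq_on_X_if_eq_on_orbit:
  fixes f g :: "'a \<Rightarrow> 'b::metric_space"
  assumes dense: "X \<subseteq> closure (range (\<lambda>n::nat. orb x (int n)))" and x: "x \<in> X"
    and cont: "continuous_on X f" "continuous_on X g"
    and eq: "\<And>n::nat. f (orb x (int n)) = g (orb x (int n))" and y: "y \<in> X"
  shows "f y = g y"
proof -
  let ?O = "range (\<lambda>n::nat. orb x (int n))"
  have "closure ?O = X"
    using dense closure_minimal[of ?O X] closed_X orb_in_X[OF x] by auto
  moreover have "closed {z \<in> X. dist (f z) (g z) = 0}"
    by (intro continuous_closed_preimage_constant continuous_on_dist cont closed_X)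
  then have "closure ?O \<subseteq> {z \<in> X. dist (f z) (g z) = 0}"
    using eq orb_in_X[OF x] by (intro closure_minimal) auto
  ultimately show ?thesis using y by auto
qed

end

subsection \<open>Koopman eigenfunctions from orbit extensions\<close>

text \<open>Elements of the RKHS are controlled only on \<open>X\<close>; the completion absorbs
  their arbitrary behaviour on the null complement.\<close>

lemma borel_measurable_completion_AE:
  assumes g: "g \<in> borel_measurable M" and eq: "AE x in M. f x = g x"
  shows "f \<in> borel_measurable (completion M)"
proof (rule measurableI)
  fix A :: "'b set" assume "A \<in> sets borel"
  then have gA: "g -` A \<inter> space M \<in> sets (completion M)"
    using measurable_sets[OF g] by simp
  have ae: "AE x in completion M. x \<in> g -` A \<inter> space M \<longleftrightarrow> x \<in> f -` A \<inter> space M"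
    by (rule AE_completion) (use eq in eventually_elim, simp)
  have "f -` A \<inter> space M \<in> sets (completion M)"
    by (rule completion.in_sets_AE[OF ae gA]) simp
  then show "f -` A \<inter> space (completion M) \<in> sets (completion M)" by simp
qed simp

text \<open>This is the derivative of the exponential at 0, put in the form in which it enters the
  generator.\<close>

lemma tendsto_cis_difference_quotient:
  "((\<lambda>t. (cis (\<beta> * t) - 1) / of_real t) \<longlongrightarrow> \<i> * of_real \<beta>) (at 0)"
proof -
  have "((\<lambda>t. exp (t *\<^sub>R (\<i> * of_real \<beta>))) has_vector_derivative \<i> * of_real \<beta>) (at 0)"
    using exp_scaleR_has_vector_derivative_right[of "\<i> * of_real \<beta>" 0 UNIV] by simp
  then have "((\<lambda>t. norm (exp (t *\<^sub>R (\<i> * of_real \<beta>)) - 1 - t *\<^sub>R (\<i> * of_real \<beta>)) / norm t) \<longlongrightarrow> 0) (at 0)"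
    by (simp add: has_vector_derivative_def has_derivative_at)
  moreover have "eventually (\<lambda>t. norm (exp (t *\<^sub>R (\<i> * of_real \<beta>)) - 1 - t *\<^sub>R (\<i> * of_real \<beta>)) / norm t
      = norm ((cis (\<beta> * t) - 1) / of_real t - \<i> * of_real \<beta>)) (at 0)"
  proof -
    have "norm (exp (t *\<^sub>R (\<i> * of_real \<beta>)) - 1 - t *\<^sub>R (\<i> * of_real \<beta>)) / norm t
      = norm ((cis (\<beta> * t) - 1) / of_real t - \<i> * of_real \<beta>)" if "t \<noteq> 0" for t
    proof -
      have "exp (t *\<^sub>R (\<i> * of_real \<beta>)) = cis (\<beta> * t)"
        by (simp add: cis_conv_exp scaleR_conv_of_real ac_simps)
      moreover have "(cis (\<beta> * t) - 1) / of_real t - \<i> * of_real \<beta>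
          = (cis (\<beta> * t) - 1 - t *\<^sub>R (\<i> * of_real \<beta>)) / of_real t"
        using that by (simp add: scaleR_conv_of_real field_simps)
      ultimately show ?thesis by (simp add: norm_divide)
    qed
    then show ?thesis by (simp add: eventually_at_filter)
  qed
  ultimately have "((\<lambda>t. norm ((cis (\<beta> * t) - 1) / of_real t - \<i> * of_real \<beta>)) \<longlongrightarrow> 0) (at 0)"
    by (rule Lim_transform_eventually)
  then show ?thesis by (simp add: tendsto_norm_zero_iff LIM_zero_iff)
qed

context ergodic_sampled_flow
begin

section \<open>Eigenfunctions in \<open>L2\<close> from pointwise equations on the support\<close>

lemma L2_norm_AE_const:
  assumes "AE x in \<mu>. cmod (f x) = C" "0 \<le> C"
  shows "L2_norm \<mu> f = C"
proof -
  have eq: "AE x in \<mu>. (cmod (f x))\<^sup>2 = C\<^sup>2" using assms(1) by eventually_elim simp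
  interpret completion: prob_space "completion \<mu>" by (rule prob_space_completion)
  have "(\<integral>x. (cmod (f x))\<^sup>2 \<partial>completion \<mu>) = (\<integral>x. C\<^sup>2 \<partial>completion \<mu>)"
    using borel_measurable_completion_AE[OF _ eq] AE_completion[OF eq]
    by (intro integral_cong_AE) auto
  also have "\<dots> = C\<^sup>2" using completion.prob_space by simp
  finally show ?thesis using assms(2) by (simp add: L2_norm_def)
qed

text \<open>Almost everywhere \<open>f\<close> equals its extension by zero from the closed set
  \<open>X\<close>, which is Borel, and compactness of \<open>X\<close> bounds it there.\<close>

lemma L2_I:
  assumes cont: "continuous_on X f"
  shows "f \<in> L2 \<mu>"
proof -
  interpret completion: prob_space "completion \<mu>" by (rule prob_space_completion)
  have "(\<lambda>x. indicator X x *\<^sub>R f x) \<in> borel_measurable \<mu>"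
    using borel_measurable_continuous_on_indicator[OF _ cont] closed_X measurable_cong_sets[OF sets_eq refl]
    by auto
  moreover have "AE x in \<mu>. f x = indicator X x *\<^sub>R f x"
    using AE_in_X by eventually_elim simp
  ultimately have f: "f \<in> borel_measurable (completion \<mu>)"
    by (rule borel_measurable_completion_AE)
  obtain B where B: "\<And>x. x \<in> X \<Longrightarrow> cmod (f x) \<le> B"
    using compact_imp_bounded[OF compact_continuous_image[OF cont compact_support]]
    by (auto simp: bounded_iff)
  have "AE x in completion \<mu>. norm ((cmod (f x))\<^sup>2) \<le> B\<^sup>2"
  proof (rule AE_completion)
    show "AE x in \<mu>. norm ((cmod (f x))\<^sup>2) \<le> B\<^sup>2"
      using AE_in_X by eventually_elim (simp add: B power_mono)
  qed
  then have "integrable (completion \<mu>) (\<lambda>x. (cmod (f x))\<^sup>2)"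
    by (rule completion.integrable_const_bound) (use f in measurable)
  with f show ?thesis by (simp add: L2_def)
qed

lemma koopman_eigenfunctionI:
  assumes cont: "continuous_on X h" and unit: "\<And>x. x \<in> X \<Longrightarrow> cmod (h x) = 1"
    and eig: "\<And>x. x \<in> X \<Longrightarrow> h (\<Phi> t x) = c * h x"
  shows "koopman_eigenfunction \<mu> \<Phi> t c h"
  unfolding koopman_eigenfunction_def
proof (intro conjI)
  show "h \<in> L2 \<mu>" by (rule L2_I[OF cont])
  show "\<not> (AE x in \<mu>. h x = 0)"
  proof
    assume "AE x in \<mu>. h x = 0"
    with AE_in_X have "AE x in \<mu>. False" by eventually_elim (use unit in force)
    then show False by simp
  qed
  show "AE x in \<mu>. koopman \<Phi> t h x = c * h x"
    using AE_in_X by eventually_elim (simp add: koopman_def eig)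
qed

text \<open>Unit modulus on \<open>X\<close> collapses the \<open>L2\<close> norm of the error in
  the difference quotient to the scalar \<open>?D t\<close>, whose limit is the modulus of
  \<open>\<i> * \<beta> - \<i> * \<omega>\<close>. The equivalence later gives uniqueness of the
  integer \<open>q\<close>.\<close>

lemma generator_eigenfunction_iff:
  assumes cont: "continuous_on X h" and unit: "\<And>x. x \<in> X \<Longrightarrow> cmod (h x) = 1"
    and eig: "\<And>t x. x \<in> X \<Longrightarrow> h (\<Phi> t x) = cis (\<beta> * t) * h x"
  shows "generator_eigenfunction \<mu> \<Phi> \<omega> h \<longleftrightarrow> \<omega> = \<beta>"
proof -
  let ?D = "\<lambda>t. cmod ((cis (\<beta> * t) - 1) / of_real t - \<i> * of_real \<omega>)"
  have "L2_norm \<mu> (\<lambda>x. (koopman \<Phi> t h x - h x) / of_real t - \<i> * of_real \<omega> * h x) = ?D t" for t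
  proof (rule L2_norm_AE_const)
    show "AE x in \<mu>. cmod ((koopman \<Phi> t h x - h x) / of_real t - \<i> * of_real \<omega> * h x) = ?D t"
      using AE_in_X
    proof eventually_elim
      case (elim x)
      have "(koopman \<Phi> t h x - h x) / of_real t - \<i> * of_real \<omega> * h x
          = ((cis (\<beta> * t) - 1) / of_real t - \<i> * of_real \<omega>) * h x"
        by (simp add: koopman_def eig[OF elim] algebra_simps diff_divide_distrib)
      then show ?case by (simp add: norm_mult unit[OF elim])
    qed
  qed simp
  moreover have "h \<in> L2 \<mu>" "(\<lambda>x. \<i> * of_real \<omega> * h x) \<in> L2 \<mu>"
    by (intro L2_I cont continuous_on_mult continuous_on_const)+
  moreover have "\<not> (AE x in \<mu>. h x = 0)"
    using koopman_eigenfunctionI[OF cont unit eig] by (auto simp: koopman_eigenfunction_def)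
  ultimately have "generator_eigenfunction \<mu> \<Phi> \<omega> h \<longleftrightarrow> (?D \<longlongrightarrow> 0) (at 0)"
    by (simp add: generator_eigenfunction_def koopman_generator_def)
  also have lim: "(?D \<longlongrightarrow> cmod (\<i> * of_real \<beta> - \<i> * of_real \<omega>)) (at 0)"
    by (rule tendsto_norm[OF tendsto_diff[OF tendsto_cis_difference_quotient tendsto_const]])
  have "(?D \<longlongrightarrow> 0) (at 0) \<longleftrightarrow> cmod (\<i> * of_real \<beta> - \<i> * of_real \<omega>) = 0"
    using lim tendsto_unique[OF _ lim, of 0] by auto
  also have "\<dots> \<longleftrightarrow> \<omega> = \<beta>"
    by auto
  finally show ?thesis .
qed

section \<open>Propagation of orbit values to the support and to all real times\<close>

lemma continuous_on_X_flow:
  assumes "continuous_on X h"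
  shows "continuous_on X (\<lambda>x. h (\<Phi> t x))"
  by (rule continuous_on_compose2[OF assms continuous_on_subset[OF continuous_on_flow]])
    (auto simp: flow_X)

text \<open>The step relation and the unit modulus hold on the forward orbit, and density carries
  them to \<open>X\<close>. Iteration covers nonnegative sampling times, and inversion covers
  negative ones.\<close>

lemma orbit_extension_eigenvalue:
  assumes x: "x \<in> X" and dense: "X \<subseteq> closure (range (\<lambda>n::nat. orb x (int n)))"
    and cont: "continuous_on X h"
    and h: "\<And>n::nat. h (orb x (int n)) = cis (of_int (int n) * \<omega> * \<Delta>t)"
  shows "y \<in> X \<Longrightarrow> h (\<Phi> \<Delta>t y) = cis (\<omega> * \<Delta>t) * h y"
    and "y \<in> X \<Longrightarrow> cmod (h y) = 1"
    and "y \<in> X \<Longrightarrow> h (orb y m) = cis (of_int m * \<omega> * \<Delta>t) * h y"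
proof -
  note eqI = eq_on_X_if_eq_on_orbit[OF dense x]
  have step: "h (\<Phi> \<Delta>t y) = cis (\<omega> * \<Delta>t) * h y" if "y \<in> X" for y
  proof (rule eqI[OF continuous_on_X_flow[OF cont] continuous_on_mult[OF continuous_on_const cont] _ that])
    fix n :: nat
    have "h (\<Phi> \<Delta>t (orb x (int n))) = h (orb x (int (Suc n)))"
      using flow_orb[of 1 x "int n"] by simp
    also have "\<dots> = cis (\<omega> * \<Delta>t) * h (orb x (int n))"
      unfolding h by (simp add: cis_mult algebra_simps)
    finally show "h (\<Phi> \<Delta>t (orb x (int n))) = cis (\<omega> * \<Delta>t) * h (orb x (int n))" .
  qed
  then show "y \<in> X \<Longrightarrow> h (\<Phi> \<Delta>t y) = cis (\<omega> * \<Delta>t) * h y" .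
  show "cmod (h y) = 1" if "y \<in> X"
    by (rule eqI[OF continuous_on_norm[OF cont] continuous_on_const _ that]) (simp add: h)
  have nat: "h (orb y (int n)) = cis (of_int (int n) * \<omega> * \<Delta>t) * h y" if "y \<in> X" for y n
  proof (induction n)
    case 0
    then show ?case by (simp add: orb_0)
  next
    case (Suc n)
    have "h (orb y (int (Suc n))) = h (\<Phi> \<Delta>t (orb y (int n)))"
      using flow_orb[of 1 y "int n"] by simp
    also have "\<dots> = cis (\<omega> * \<Delta>t) * (cis (of_int (int n) * \<omega> * \<Delta>t) * h y)"
      by (simp only: step[OF orb_in_X[OF that]] Suc)
    also have "\<dots> = cis (of_int (int (Suc n)) * \<omega> * \<Delta>t) * h y"
      unfolding mult.assoc[symmetric] cis_mult by (simp add: algebra_simps)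
    finally show ?case .
  qed
  show "h (orb y m) = cis (of_int m * \<omega> * \<Delta>t) * h y" if y: "y \<in> X"
  proof (cases "m \<ge> 0")
    case True
    then show ?thesis using nat[OF y, of "nat m"] by simp
  next
    case False
    \<comment> \<open>For negative \<open>m\<close> the point \<open>y\<close> is reached from
      \<open>orb y m\<close> by \<open>- m\<close> forward steps.\<close>
    have "h y = h (orb (orb y m) (int (nat (- m))))"
      using False orb_flow[of m y "- m"] by (simp add: orb_0 flip: sampled_orbit_def)
    also have "\<dots> = cis (- (of_int m * \<omega> * \<Delta>t)) * h (orb y m)"
      using nat[OF orb_in_X[OF y], of m "nat (- m)"] False by simp
    finally show ?thesis by (simp add: cis_mult flip: mult.assoc)
  qed
qed

text \<open>Since \<open>h \<circ> \<Phi> t\<close> also satisfies the eigenvalue equation, it agrees with \<open>h (\<Phi> t x) \<cdot> h\<close> on the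
  orbit of \<open>x\<close>, hence on \<open>X\<close>; so \<open>t \<mapsto> h (\<Phi> t x)\<close> is a character of the real line.\<close>

lemma orbit_extension_eigenfrequency:
  assumes x: "x \<in> X" and dense: "X \<subseteq> closure (range (\<lambda>n::nat. orb x (int n)))"
    and cont: "continuous_on X h"
    and h: "\<And>n::nat. h (orb x (int n)) = cis (of_int (int n) * \<omega> * \<Delta>t)"
  shows "\<exists>\<beta>. \<forall>t. \<forall>y\<in>X. h (\<Phi> t y) = cis (\<beta> * t) * h y"
proof -
  note eig = orbit_extension_eigenvalue[OF assms]
  define c where "c t = h (\<Phi> t x)" for t
  have c: "h (\<Phi> t y) = c t * h y" if "y \<in> X" for t y
  proof (rule eq_on_X_if_eq_on_orbit[OF dense x continuous_on_X_flow[OF cont]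
        continuous_on_mult[OF continuous_on_const cont] _ that])
    fix n :: nat
    \<comment> \<open>Flow maps commute, so this is a point of the orbit of
      \<open>\<Phi> t x\<close>, to which the eigenvalue relation applies.\<close>
    have "h (\<Phi> t (orb x (int n))) = h (orb (\<Phi> t x) (int n))"
      by (simp add: sampled_orbit_def add.commute flip: flow_add)
    then show "h (\<Phi> t (orb x (int n))) = c t * h (orb x (int n))"
      using eig(3)[OF flow_X[OF x]] by (simp add: h c_def)
  qed
  have "continuous_on UNIV c"
    unfolding c_def by (rule continuous_on_compose2[OF cont continuous_on_orbit]) (auto simp: flow_X x)
  \<comment> \<open>The relation for time \<open>s\<close>, taken at the point
    \<open>\<Phi> t x\<close> of \<open>X\<close>.\<close>
  moreover have "c (s + t) = c s * c t" for s t
    using c[OF flow_X[OF x], of s t] by (simp add: c_def flow_add)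
  moreover have "cmod (c t) = 1" for t
    using eig(2)[OF flow_X[OF x]] by (simp add: c_def)
  ultimately obtain \<beta> where "\<And>t. c t = cis (\<beta> * t)"
    using continuous_character_eq_cis[of c] by blast
  with c show ?thesis by auto
qed

end

section \<open>Energy dichotomy and eigenfunctions for almost every starting point\<close>

theorem theorem1:
  fixes \<Phi> :: "real \<Rightarrow> 'a::metric_space \<Rightarrow> 'a"
    and \<mu> :: "'a measure"
    and X :: "'a set"
    and \<Delta>t :: real
    and k :: "'a \<Rightarrow> 'a \<Rightarrow> real"
    and H :: "('a \<Rightarrow> complex) set"
    and ip :: "('a \<Rightarrow> complex) \<Rightarrow> ('a \<Rightarrow> complex) \<Rightarrow> complex"
  assumes "continuous_flow \<Phi>"
    and "prob_space \<mu>" and "sets \<mu> = sets borel"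
    and "invariant_measure \<mu> \<Phi>"
    and "ergodic_measure \<mu> \<Phi>"
    and "is_support \<mu> X" and "compact X"
    and "\<not> (\<exists>p. X = {p} \<and> (\<forall>t. \<Phi> t p = p))"
    and "\<Delta>t > 0"
    and "ergodic_measure \<mu> (\<lambda>n::int. \<Phi> (of_int n * \<Delta>t))"
    and "rkhs H ip k"
    and "continuous_on (X \<times> X) (\<lambda>(x, y). k x y)"
    and "strictly_positive_definite_on X k"
  shows "AE x\<^sub>0 in \<mu>. \<forall>\<omega>.
    (let Orb = range (sampled_orbit \<Phi> \<Delta>t x\<^sub>0);
         f = orbit_fourier \<Phi> \<Delta>t x\<^sub>0 \<omega>;
         w = (\<lambda>N. extension_energy ip k (trajectory \<Phi> \<Delta>t x\<^sub>0 N) f)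
     in (filterlim w at_top sequentially \<longleftrightarrow> \<not> (\<exists>h. is_extension H Orb f h)) \<and>
        ((\<exists>h. is_extension H Orb f h) \<longrightarrow>
           (\<exists>!h. is_minimal_extension H ip Orb f h) \<and>
           (\<forall>h. is_minimal_extension H ip Orb f h \<longrightarrow> w \<longlonglongrightarrow> (rk_norm ip h)\<^sup>2) \<and>
           (\<forall>h. is_extension H Orb f h \<longrightarrow>
              koopman_eigenfunction \<mu> \<Phi> \<Delta>t (cis (\<omega> * \<Delta>t)) h \<and>
              (\<exists>!q::int. generator_eigenfunction \<mu> \<Phi> (\<omega> + 2 * pi * of_int q / \<Delta>t) h))))"
proof -
  interpret ergodic_sampled_flow \<Phi> \<mu> X \<Delta>t
    by (rule ergodic_sampled_flow.intro) fact+
  interpret rkhs H ip k by fact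
  note spd = \<open>strictly_positive_definite_on X k\<close>
  show ?thesis
    \<comment> \<open>Neither condition on the starting point involves \<omega>, so one null set
      serves all frequencies.\<close>
    using AE_in_X AE_orbit_dense
  proof eventually_elim
    case (elim x)
    note x = elim(1) and dense = elim(2)
    show ?case
    proof
      fix \<omega>
      let ?Orb = "range (orb x)"
      let ?f = "orbit_fourier \<Phi> \<Delta>t x \<omega>"
      let ?S = "trajectory \<Phi> \<Delta>t x"
      \<comment> \<open>Distinctness of the orbit points makes \<open>the_inv\<close> return the
        index \<open>n\<close>.\<close>
      have f: "?f (orb x n) = cis (of_int n * \<omega> * \<Delta>t)" for n
        by (simp add: orbit_fourier_def the_inv_f_f[OF inj_orbit[OF x dense]])
      have S: "incseq ?S" "\<And>N. finite (?S N)" "\<And>N. ?S N \<subseteq> X"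
        using orb_in_X[OF x] by (auto simp: trajectory_def incseq_def)
      have US: "(\<Union>N. ?S N) = range (\<lambda>n::nat. orb x (int n))"
        by (auto simp: trajectory_def)
      have data: "continuous_on X h \<and> (\<forall>n::nat. h (orb x (int n)) = cis (of_int (int n) * \<omega> * \<Delta>t))"
        if "is_extension H (\<Union>N. ?S N) ?f h" for h
        using that rkhs_continuous_on[OF \<open>rkhs H ip k\<close> \<open>continuous_on (X \<times> X) _\<close>, of h]
        unfolding US is_extension_def by (auto simp: f)
      \<comment> \<open>The trajectories exhaust only the forward orbit. The value 1 at index 0 and
        the relation for negative \<open>n\<close> fix the backward orbit.\<close>
      have ext: "is_extension H ?Orb ?f h \<longleftrightarrow> is_extension H (\<Union>N. ?S N) ?f h" for h
      proof
        assume "is_extension H ?Orb ?f h"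
        then show "is_extension H (\<Union>N. ?S N) ?f h"
          by (rule is_extension_mono) (auto simp: US)
      next
        assume h: "is_extension H (\<Union>N. ?S N) ?f h"
        note d = data[OF h, THEN conjunct1] data[OF h, THEN conjunct2, rule_format]
        have "h (orb x n) = ?f (orb x n)" for n
          using orbit_extension_eigenvalue(3)[OF x dense d x, of n] d(2)[of 0] by (simp add: f orb_0)
        then show "is_extension H ?Orb ?f h" using h by (auto simp: is_extension_def)
      qed
      have min: "is_minimal_extension H ip ?Orb ?f h \<longleftrightarrow> is_minimal_extension H ip (\<Union>N. ?S N) ?f h" for h
        by (simp only: is_minimal_extension_def ext)
      have eig: "koopman_eigenfunction \<mu> \<Phi> \<Delta>t (cis (\<omega> * \<Delta>t)) h \<and>
          (\<exists>!q::int. generator_eigenfunction \<mu> \<Phi> (\<omega> + 2 * pi * of_int q / \<Delta>t) h)"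
        if h: "is_extension H (\<Union>N. ?S N) ?f h" for h
      proof -
        note d = data[OF h, THEN conjunct1] data[OF h, THEN conjunct2, rule_format]
        note eig = orbit_extension_eigenvalue[OF x dense d]
        obtain \<beta> where \<beta>: "\<And>t y. y \<in> X \<Longrightarrow> h (\<Phi> t y) = cis (\<beta> * t) * h y"
          using orbit_extension_eigenfrequency[OF x dense d] by blast
        have "h x \<noteq> 0" using eig(2)[OF x] by auto
        \<comment> \<open>Comparing both eigenvalue relations at time \<Delta>t identifies the two
          frequencies up to a multiple of \<open>2 * pi / \<Delta>t\<close>.\<close>
        then have "cis (\<beta> * \<Delta>t) = cis (\<omega> * \<Delta>t)" using \<beta>[OF x, of \<Delta>t] eig(1)[OF x] by simp
        then obtain q :: int where q: "\<beta> * \<Delta>t = \<omega> * \<Delta>t + 2 * pi * of_int q"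
          using sin_cos_eq_iff[of "\<beta> * \<Delta>t" "\<omega> * \<Delta>t"] by (auto simp: cis.ctr complex_eq_iff)
        \<comment> \<open>The generator admits only the frequency \<beta> for \<open>h\<close>, so
          uniqueness of the integer reduces to this equation.\<close>
        have "\<omega> + 2 * pi * of_int p / \<Delta>t = \<beta> \<longleftrightarrow> p = q" for p :: int
        proof -
          have "\<omega> + 2 * pi * of_int p / \<Delta>t = \<beta> \<longleftrightarrow> \<omega> * \<Delta>t + 2 * pi * of_int p = \<beta> * \<Delta>t"
            using step_pos by (simp add: field_simps)
          then show ?thesis by (simp add: q)
        qed
        then have "\<exists>!q::int. generator_eigenfunction \<mu> \<Phi> (\<omega> + 2 * pi * of_int q / \<Delta>t) h"
          by (simp add: generator_eigenfunction_iff[OF d(1) eig(2) \<beta>])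
        then show ?thesis using koopman_eigenfunctionI[OF d(1) eig(2,1)] by blast
      qed
      show "let Orb = ?Orb; f = ?f; w = (\<lambda>N. extension_energy ip k (?S N) f)
        in (filterlim w at_top sequentially \<longleftrightarrow> \<not> (\<exists>h. is_extension H Orb f h)) \<and>
          ((\<exists>h. is_extension H Orb f h) \<longrightarrow>
           (\<exists>!h. is_minimal_extension H ip Orb f h) \<and>
           (\<forall>h. is_minimal_extension H ip Orb f h \<longrightarrow> w \<longlonglongrightarrow> (rk_norm ip h)\<^sup>2) \<and>
           (\<forall>h. is_extension H Orb f h \<longrightarrow>
              koopman_eigenfunction \<mu> \<Phi> \<Delta>t (cis (\<omega> * \<Delta>t)) h \<and>
              (\<exists>!q::int. generator_eigenfunction \<mu> \<Phi> (\<omega> + 2 * pi * of_int q / \<Delta>t) h)))"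
        unfolding Let_def ext min
        using extension_energy_at_top_iff[OF spd S, of ?f] minimal_extension[OF spd S, of ?f] eig
        by blast
    qed
  qed
qed

end
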